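(* Let $k\ge2$ and $N\ge3$ be integers and let $$A(2k,2N)=\bigcup_{r=1}^{2N}\Big[\,2\Big\lfloor\frac{4N}{r}\Big\rfloor(2k-1)\Big]_0\times[2r(2k-1)]_0\subseteq\mathbb{Z}^2 .$$ Consider the class of all polygonal regions $P\subseteq[0,1)^2$, with vertices in $[0,1)^2$, having at most $N$ vertices and whose edges have at most $k$ different slopes (the slopes are not prescribed and may vary with $P$). Then every $P$ in this class is determined, within the class, by the values of $\widehat{\mathbb{1}_P}$ on $A(2k,2N)$: if $P,Q$ belong to the class and $\widehat{\mathbb{1}_P}(a)=\widehat{\mathbb{1}_Q}(a)$ for all $a\in A(2k,2N)$, then $P=Q$. Moreover $|A(2k,2N)|=O(k^2N\log N)$ with an absolute implied constant.
   Context: For an integer $m\ge0$, $[m]_0=\{0,1,\ldots,m\}$. A polygonal region is given by an ordered sequence of vertices $v_0,\ldots,v_{n-1}\in\mathbb{R}^2$ ($n\ge 3$) which, joined cyclically by line segments (edges) $v_jv_{j+1}$ (indices mod $n$) that do not intersect except at the vertices, form a simple closed polygonal curve; successive edges are not parallel. The polygonal region is the interior (the bounded open region enclosed) of this curve. The number of different slopes is the number of different directions of edges, parallel edges having the same slope. $\mathbb{1}_P$ is the indicator function of $P$ and $\widehat{g}(t)=\int_{\mathbb{R}^2}g(x)e^{-2\pi i x\cdot t}\,dx$ (with $g$ extended by $0$ outside its domain). *)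

theory Defs
  imports "HOL-Analysis.Analysis"
begin

type_synonym plane = "real \<times> real"

definition unit_square :: "plane set" where
  "unit_square = {0..<1} \<times> {0..<1}"

text \<open>Vertex indices are read modulo the number of vertices.\<close>

definition vertex :: "plane list \<Rightarrow> nat \<Rightarrow> plane" where
  "vertex vs j = vs ! (j mod length vs)"

definition edge :: "plane list \<Rightarrow> nat \<Rightarrow> plane set" where
  "edge vs j = closed_segment (vertex vs j) (vertex vs (Suc j))"

definition boundary_curve :: "plane list \<Rightarrow> plane set" where
  "boundary_curve vs = (\<Union>j<length vs. edge vs j)"

text \<open>The slope of an edge is the line through the origin parallel to it, so that
  vertical edges need no special treatment and the orientation of an edge is irrelevant.\<close>

definition slope :: "plane list \<Rightarrow> nat \<Rightarrow> plane set" where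
  "slope vs j = span {vertex vs (Suc j) - vertex vs j}"

definition slopes :: "plane list \<Rightarrow> plane set set" where
  "slopes vs = slope vs ` {..<length vs}"

text \<open>The curve is simple: the vertices are pairwise distinct, and two different edges meet
  at most in a common endpoint. In particular no vertex lies in the relative interior of an edge.\<close>

definition simple_polygon :: "plane list \<Rightarrow> bool" where
  "simple_polygon vs \<longleftrightarrow>
     3 \<le> length vs \<and> distinct vs \<and>
     (\<forall>i<length vs. \<forall>j<length vs. i \<noteq> j \<longrightarrow>
        edge vs i \<inter> edge vs j \<subseteq>
          {vertex vs i, vertex vs (Suc i)} \<inter> {vertex vs j, vertex vs (Suc j)}) \<and>
     (\<forall>j<length vs. slope vs j \<noteq> slope vs (Suc j))"

definition polygonal_region :: "plane list \<Rightarrow> plane set" where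
  "polygonal_region vs = inside (boundary_curve vs)"

definition polygon_class :: "nat \<Rightarrow> nat \<Rightarrow> plane set set" where
  "polygon_class k N =
     {P. P \<subseteq> unit_square \<and>
         (\<exists>vs. simple_polygon vs \<and> P = polygonal_region vs \<and> set vs \<subseteq> unit_square \<and>
               length vs \<le> N \<and> card (slopes vs) \<le> k)}"

definition fourier :: "(plane \<Rightarrow> complex) \<Rightarrow> plane \<Rightarrow> complex" where
  "fourier g t = (\<integral>x. g x * exp (- 2 * of_real pi * \<i> * of_real (x \<bullet> t)) \<partial>lborel)"

text \<open>\<open>sample_set k N\<close> is the set written $A(2k,2N)$; the doubling of both parameters is
  built into the formula.\<close>

definition sample_set :: "nat \<Rightarrow> nat \<Rightarrow> (int \<times> int) set" where
  "sample_set k N =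
     (\<Union>r\<in>{1..2 * N}. {0..2 * \<lfloor>4 * real N / real r\<rfloor> * (2 * int k - 1)} \<times>
                       {0..2 * int r * (2 * int k - 1)})"

lemma finite_sample_set: "finite (sample_set k N)"
  by (simp add: sample_set_def)

end

(* With c = -2 pi i, Green's formula turns c^2 xi_2 times the Fourier transform of a polygon into
   the sum of (dx_j / (e_j . xi)) (exp(c v_{j+1} . xi) - exp(c v_j . xi)) over its edges e_j, up to sign.
   Multiplying by one linear form per slope clears the denominators, so that the difference of two
   polygons in the class becomes an exponential polynomial with at most 2N frequencies (the vertices)
   and coefficients of degree less than 2k in each variable. An exponential polynomial of this kind
   that vanishes on the hyperbolic cross of samples is identically zero. Hence both Fourier transforms
   agree, and by the Stone-Weierstrass theorem and the Jordan curve theorem so do the regions.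

   Instead of Green's formula, the indicator function of the region is written as the signed sum of
   the indicator functions of the trapezoids below the edges: the winding number of the boundary
   around a point counts the signed crossings with the vertical ray above that point. *)
theory Submission
  imports Defs "HOL-Complex_Analysis.Complex_Analysis"
begin

section \<open>Exponential polynomials\<close>

text \<open>Slopes are not prescribed, so the denominators are cleared with the union of the slopes
  of both regions, and the frequencies are the union of both vertex sets: this is the origin of
  \<open>2k\<close> and \<open>2N\<close>. Clearing cancels the form of each edge's own slope, which
  keeps the degree in each variable strictly below the number of slopes. Samples at which a form or
  a coordinate vanishes cause no trouble, because the cleared identity extends to all frequencies by
  continuity. An integer sample sees a vertex only through the exponentials of its two coordinates;
  these separate points because the square is half-open. A full grid for two-dimensional uniqueness
  would need about \<open>N\<close> columns of samples with about \<open>N\<close> points each. The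
  hyperbolic cross comes from the trade-off that few vertical lines can carry many vertices: long
  columns need many samples vertically but few horizontally. The conclusion at the samples is that
  all polynomial coefficients vanish, so the exponential polynomial is zero at every real frequency
  and not only at integer ones. The transforms then fix the regions only up to null sets; the last
  gap is closed because the inside of a Jordan curve is the interior of its closure.\<close>

lemma degree_shift_poly [simp]:
  fixes p :: "'a::field_char_0 poly"
  shows "degree (p \<circ>\<^sub>p [:1, 1:]) = degree p"
  by (simp add: degree_pcompose)

lemma lead_coeff_shift_poly:
  fixes p :: "'a::field_char_0 poly"
  shows "coeff (p \<circ>\<^sub>p [:1, 1:]) (degree p) = lead_coeff p"
  using lead_coeff_comp[of "[:1, 1::'a:]" p] by simp

text \<open>The shift preserves the leading coefficient, so comparing leading coefficients on both
  sides forces it to be zero.\<close>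

lemma shift_poly_eigen_imp_0:
  fixes p :: "'a::field_char_0 poly"
  assumes "smult a (p \<circ>\<^sub>p [:1, 1:]) = smult b p" "a \<noteq> b"
  shows "p = 0"
proof -
  have "a * lead_coeff p = b * lead_coeff p"
    using arg_cong[OF assms(1), of "\<lambda>q. coeff q (degree p)"] lead_coeff_shift_poly[of p] by simp
  with assms(2) show ?thesis by simp
qed

text \<open>The leading terms cancel. The alternative of a zero difference covers constants, for
  which \<open>degree < n - 1\<close> fails when \<open>n = 1\<close>.\<close>

lemma degree_shift_poly_diff_less:
  fixes p :: "'a::field_char_0 poly"
  assumes "degree p < n"
  shows "p \<circ>\<^sub>p [:1, 1:] - p = 0 \<or> degree (p \<circ>\<^sub>p [:1, 1:] - p) < n - 1"
proof (cases "degree p = 0")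
  case True
  then obtain c where "p = [:c:]" by (meson degree_eq_zeroE)
  then show ?thesis by simp
next
  case False
  have "degree (p \<circ>\<^sub>p [:1, 1:] - p) \<le> degree p - 1"
  proof (rule degree_le, intro allI impI)
    fix i assume "degree p - 1 < i"
    then consider "i = degree p" | "degree p < i" using False by linarith
    then show "coeff (p \<circ>\<^sub>p [:1, 1:] - p) i = 0"
      by cases (simp_all add: lead_coeff_shift_poly coeff_eq_0)
  qed
  with False assms show ?thesis by linarith
qed

text \<open>Such a polynomial takes one value at all natural numbers, which are infinitely many
  points in characteristic 0.\<close>

lemma shift_poly_fixed_imp_const:
  fixes p :: "'a::field_char_0 poly"
  assumes "p \<circ>\<^sub>p [:1, 1:] = p"
  shows "p = [:poly p 0:]"
proof -
  have "poly p (of_nat m) = poly p 0" for m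
  proof (induction m)
    case (Suc m)
    have "poly p (of_nat (Suc m)) = poly (p \<circ>\<^sub>p [:1, 1:]) (of_nat m)"
      by (simp add: poly_pcompose add.commute)
    with assms Suc show ?case by simp
  qed simp
  then have "poly (p - [:poly p 0:]) (of_nat m) = 0" for m by simp
  then have "range of_nat \<subseteq> {x. poly (p - [:poly p 0:]) x = 0}" by auto
  moreover have "infinite (range (of_nat :: nat \<Rightarrow> 'a))"
    by (simp add: finite_image_iff inj_of_nat)
  ultimately have "p - [:poly p 0:] = 0"
    using poly_roots_finite finite_subset by blast
  then show ?thesis by (metis eq_iff_diff_eq_0)
qed

text \<open>The operator \<open>E - l\<^sub>0\<close> (\<open>E\<close> the shift) lowers the degree at \<open>l\<^sub>0\<close>
  and preserves the degrees at the other frequencies.\<close>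

lemma exponential_polynomial_unique:
  fixes p :: "'a::field_char_0 \<Rightarrow> 'a poly" and d :: "'a \<Rightarrow> nat"
  assumes "finite L" "0 \<notin> L"
    and "\<And>l. l \<in> L \<Longrightarrow> p l = 0 \<or> degree (p l) < d l"
    and "\<And>m. m < (\<Sum>l\<in>L. d l) \<Longrightarrow> (\<Sum>l\<in>L. l ^ m * poly (p l) (of_nat m)) = 0"
    and "l \<in> L"
  shows "p l = 0"
  using assms(3-5)
\<comment> \<open>The induction is on the total number of free coefficients, which equals the number
  of samples assumed to vanish. If it is 0, every bound \<open>d l\<close> is 0 and only the
  alternative \<open>p l = 0\<close> remains.\<close>
proof (induction n \<equiv> "\<Sum>l\<in>L. d l" arbitrary: p d l)
  case 0
  with assms(1) have "d l = 0" by simp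
  with 0 show ?case by fastforce
next
  case (Suc n)
  note D = Suc.prems(1) and V = Suc.prems(2)
  from Suc.hyps(2) obtain l0 where l0: "l0 \<in> L" "d l0 > 0"
    by (metis gr0I nat.distinct(1) sum.neutral)
  have "l0 \<noteq> 0" using l0 assms(2) by auto
  define q where "q l = smult l (p l \<circ>\<^sub>p [:1, 1:]) - smult l0 (p l)" for l
  have sum': "n = (\<Sum>l\<in>L. (d(l0 := d l0 - 1)) l)"
  proof -
    have "(\<Sum>l\<in>L. (d(l0 := d l0 - 1)) l) = (d l0 - 1) + (\<Sum>l\<in>L - {l0}. d l)"
      using l0 assms(1) by (simp add: sum.remove)
    moreover have "(\<Sum>l\<in>L. d l) = d l0 + (\<Sum>l\<in>L - {l0}. d l)"
      using l0 assms(1) by (simp add: sum.remove)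
    ultimately show ?thesis using Suc.hyps(2) l0 by linarith
  qed
  have q0: "q l = 0" if "l \<in> L" for l
  proof (rule Suc.hyps(1)[OF sum' _ _ that])
    fix l assume l: "l \<in> L"
    show "q l = 0 \<or> degree (q l) < (d(l0 := d l0 - 1)) l"
    proof (cases "l = l0")
      case True
      then have "q l = smult l0 (p l0 \<circ>\<^sub>p [:1, 1:] - p l0)"
        by (simp add: q_def smult_diff_right)
      with D[OF l0(1)] degree_shift_poly_diff_less[of "p l0" "d l0"] True show ?thesis
        by auto
    next
      case False
      have "degree (q l) \<le> degree (p l)"
        unfolding q_def by (intro degree_diff_le order.trans[OF degree_smult_le]) simp_all
      with D[OF l] False show ?thesis by (auto simp: q_def)
    qed
  next
    \<comment> \<open>Sample \<open>m\<close> of the new sequence uses samples \<open>m\<close> and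
      \<open>m + 1\<close> of the old one; the range has become shorter by exactly one.\<close>
    fix m assume "m < (\<Sum>l\<in>L. (d(l0 := d l0 - 1)) l)"
    with sum' Suc.hyps(2) have m: "m < (\<Sum>l\<in>L. d l)" "Suc m < (\<Sum>l\<in>L. d l)" by simp_all
    have "(\<Sum>l\<in>L. l ^ m * poly (q l) (of_nat m)) =
      (\<Sum>l\<in>L. l ^ Suc m * poly (p l) (of_nat (Suc m))) - l0 * (\<Sum>l\<in>L. l ^ m * poly (p l) (of_nat m))"
      by (simp add: q_def sum_distrib_left flip: sum_subtractf)
        (intro sum.cong refl, simp add: poly_pcompose algebra_simps)
    with V[OF m(1)] V[OF m(2)] show "(\<Sum>l\<in>L. l ^ m * poly (q l) (of_nat m)) = 0"
      by simp
  qed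
  have others: "p l = 0" if "l \<in> L" "l \<noteq> l0" for l
    using q0[OF that(1)] that(2) shift_poly_eigen_imp_0[of l "p l" l0] by (simp add: q_def)
  have "smult l0 (p l0 \<circ>\<^sub>p [:1, 1:] - p l0) = 0"
    using q0[OF l0(1)] by (simp add: q_def smult_diff_right)
  with \<open>l0 \<noteq> 0\<close> have const: "p l0 = [:poly (p l0) 0:]"
    by (intro shift_poly_fixed_imp_const) simp
  \<comment> \<open>Now only a constant at \<open>l0\<close> can survive, and the single sample at 0
    evaluates it.\<close>
  have "(\<Sum>l\<in>L. l ^ 0 * poly (p l) (of_nat 0)) = 0"
    using Suc.hyps(2) by (intro V) simp
  also have "(\<Sum>l\<in>L. l ^ 0 * poly (p l) (of_nat 0)) = poly (p l0) 0"
    using l0 assms(1) others by (simp add: sum.remove)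
  finally have "p l0 = 0" using const by simp
  with others Suc.prems(3) show ?case by blast
qed

text \<open>Group the frequencies into columns with a common first coordinate. A column with at most
  \<open>r\<close> points is killed in step \<open>r\<close>, and there are at most \<open>M div r\<close> columns with at least \<open>r\<close> points.\<close>

lemma exponential_polynomial_unique_2D:
  fixes P :: "'a::field_char_0 \<times> 'a \<Rightarrow> nat \<Rightarrow> 'a poly"
  assumes "finite V" "card V \<le> M"
    and nz: "\<And>v. v \<in> V \<Longrightarrow> fst v \<noteq> 0 \<and> snd v \<noteq> 0"
    and deg: "\<And>v i. v \<in> V \<Longrightarrow> degree (P v i) < d"
    and van: "\<And>r m n. 1 \<le> r \<Longrightarrow> r \<le> M \<Longrightarrow> m < d * (M div r) \<Longrightarrow> n < d * r \<Longrightarrow>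
      (\<Sum>v\<in>V. fst v ^ m * snd v ^ n * (\<Sum>i<d. poly (P v i) (of_nat n) * of_nat m ^ i)) = 0"
    and "v \<in> V" "i < d"
  shows "P v i = 0"
proof -
  define L where "L = fst ` V"
  define C where "C l = {y. (l, y) \<in> V}" for l
  define G where "G l i n = (\<Sum>y\<in>C l. y ^ n * poly (P (l, y) i) (of_nat n))" for l i and n :: nat
  have finC: "finite (C l)" for l
    using finite_vimageI[OF \<open>finite V\<close>, of "Pair l"] by (simp add: C_def vimage_def inj_on_def)
  have finL: "finite L" using \<open>finite V\<close> by (simp add: L_def)
  have V_eq: "V = Sigma L C" by (force simp: L_def C_def)
  have cardV: "card V = (\<Sum>l\<in>L. card (C l))" using finL finC by (simp add: V_eq)
  have L0: "0 \<notin> L" using nz by (force simp: L_def)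
  have F_eq: "(\<Sum>v\<in>V. fst v ^ m * snd v ^ n * (\<Sum>i<d. poly (P v i) (of_nat n) * of_nat m ^ i)) =
      (\<Sum>l\<in>L. l ^ m * (\<Sum>i<d. G l i n * of_nat m ^ i))" for m n
  proof -
    have "(\<Sum>v\<in>V. fst v ^ m * snd v ^ n * (\<Sum>i<d. poly (P v i) (of_nat n) * of_nat m ^ i)) =
      (\<Sum>l\<in>L. \<Sum>y\<in>C l. \<Sum>i<d. l ^ m * (y ^ n * poly (P (l, y) i) (of_nat n) * of_nat m ^ i))"
      unfolding V_eq using finL finC
      by (subst sum.Sigma) (auto intro!: sum.cong simp: sum_distrib_left mult_ac)
    also have "\<dots> = (\<Sum>l\<in>L. \<Sum>i<d. \<Sum>y\<in>C l. l ^ m * (y ^ n * poly (P (l, y) i) (of_nat n) * of_nat m ^ i))"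
      by (intro sum.cong refl sum.swap)
    also have "\<dots> = (\<Sum>l\<in>L. l ^ m * (\<Sum>i<d. G l i n * of_nat m ^ i))"
      by (simp add: G_def sum_distrib_left sum_distrib_right)
    finally show ?thesis .
  qed
  \<comment> \<open>Vertical direction: within one column the points are distinct frequencies in
    \<open>n\<close>, so the one-dimensional lemma needs \<open>d\<close> samples per point.\<close>
  have colzero: "P (l, y) i = 0"
    if "\<And>n. n < d * card (C l) \<Longrightarrow> G l i n = 0" "y \<in> C l" for l i y
  proof (rule exponential_polynomial_unique[where L = "C l" and d = "\<lambda>_. d"])
    show "0 \<notin> C l" using nz by (force simp: C_def)
    show "P (l, z) i = 0 \<or> degree (P (l, z) i) < d" if "z \<in> C l" for z
      using deg[of "(l, z)" i] that by (simp add: C_def)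
  qed (use that finC in \<open>auto simp: G_def mult.commute\<close>)
  have main: "\<forall>l\<in>L. card (C l) \<le> r \<longrightarrow> (\<forall>i<d. \<forall>y\<in>C l. P (l, y) i = 0)" if "r \<le> M" for r
    using that
  proof (induction r)
    case 0
    then show ?case using finC by auto
  next
    case (Suc r)
    then have IH: "\<forall>l\<in>L. card (C l) \<le> r \<longrightarrow> (\<forall>i<d. \<forall>y\<in>C l. P (l, y) i = 0)" by simp
    define L' where "L' = {l\<in>L. card (C l) \<ge> Suc r}"
    have "card L' * Suc r = (\<Sum>l\<in>L'. Suc r)" by simp
    also have "\<dots> \<le> (\<Sum>l\<in>L'. card (C l))" by (intro sum_mono) (auto simp: L'_def)
    also have "\<dots> \<le> (\<Sum>l\<in>L. card (C l))"
      using finL by (intro sum_mono2) (auto simp: L'_def)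
    also have "\<dots> \<le> M" using cardV assms(2) by simp
    finally have cardL': "card L' \<le> M div Suc r" by (simp add: less_eq_div_iff_mult_less_eq)
    \<comment> \<open>Horizontal direction: for fixed \<open>n\<close> the sum is an exponential
      polynomial in \<open>m\<close> whose frequencies are the remaining columns and whose
      coefficients are \<open>G l i n\<close>. Their number is bounded by \<open>cardL'\<close>, so
      the available values of \<open>m\<close> suffice.\<close>
    have G0: "G l i n = 0" if l: "l \<in> L'" and n: "n < d * Suc r" and i: "i < d" for l i n
    proof -
      define p where "p l = (\<Sum>i<d. monom (G l i n) i)" for l
      have "p l = 0"
      proof (rule exponential_polynomial_unique[where L = L' and d = "\<lambda>_. d"])
        fix m assume "m < (\<Sum>l\<in>L'. d)"
        with cardL' have m: "m < d * (M div Suc r)"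
          by (simp add: mult.commute) (meson less_le_trans mult_le_mono2)
        have "0 = (\<Sum>l\<in>L. l ^ m * (\<Sum>i<d. G l i n * of_nat m ^ i))"
          using van[OF _ Suc.prems m n] F_eq by simp
        \<comment> \<open>Columns with at most \<open>r\<close> points have zero coefficients by the
          induction hypothesis and drop out.\<close>
        also have "\<dots> = (\<Sum>l\<in>L'. l ^ m * (\<Sum>i<d. G l i n * of_nat m ^ i))"
        proof (rule sum.mono_neutral_right[OF finL])
          show "\<forall>l\<in>L - L'. l ^ m * (\<Sum>i<d. G l i n * of_nat m ^ i) = 0"
          proof
            fix l assume "l \<in> L - L'"
            then have "l \<in> L" "card (C l) \<le> r" by (auto simp: L'_def)
            with IH show "l ^ m * (\<Sum>i<d. G l i n * of_nat m ^ i) = 0"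
              by (simp add: G_def)
          qed
        qed (auto simp: L'_def)
        finally show "(\<Sum>l\<in>L'. l ^ m * poly (p l) (of_nat m)) = 0"
          by (simp add: p_def poly_sum poly_monom)
      next
        show "p l = 0 \<or> degree (p l) < d" if "l \<in> L'" for l
          using i unfolding p_def
          by (intro disjI2 degree_sum_less order.strict_trans1[OF degree_monom_le]) auto
      qed (use finL L0 l in \<open>auto simp: L'_def\<close>)
      then have "coeff (p l) i = 0" by simp
      then show ?thesis using i by (simp add: p_def coeff_sum)
    qed
    show ?case
    proof (intro ballI impI allI)
      fix l i y assume l: "l \<in> L" "card (C l) \<le> Suc r" "i < d" "y \<in> C l"
      show "P (l, y) i = 0"
      proof (cases "card (C l) \<le> r")
        case True
        with IH l show ?thesis by blast
      next
        case False
        with l have "card (C l) = Suc r" "l \<in> L'" by (auto simp: L'_def)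
        with G0 l show ?thesis by (intro colzero) auto
      qed
    qed
  qed
  obtain l y where v: "v = (l, y)" by (cases v)
  have l: "l \<in> L" "y \<in> C l" using \<open>v \<in> V\<close> v by (auto simp: V_eq)
  have "card (C l) \<le> M"
    using member_le_sum[OF l(1), of "\<lambda>l. card (C l)"] finL cardV assms(2) by simp
  with main[of M] l \<open>i < d\<close> v show ?thesis by blast
qed

section \<open>Polynomial functions of bounded degree in each of two variables\<close>

text \<open>The bound is on the degree in each variable separately, not on the total degree.
  Expanding in powers of \<open>x\<close> with coefficients that are polynomials in \<open>y\<close>
  matches the shape of \<open>exponential_polynomial_unique_2D\<close>. The bound is strict and
  imposed on every \<open>P i\<close>, so \<open>d\<close> is positive.\<close>

definition bipoly :: "nat \<Rightarrow> (complex \<Rightarrow> complex \<Rightarrow> complex) \<Rightarrow> bool" where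
  "bipoly d f \<longleftrightarrow> (\<exists>P :: nat \<Rightarrow> complex poly. (\<forall>i. degree (P i) < d) \<and>
     (\<forall>x y. f x y = (\<Sum>i<d. poly (P i) y * x ^ i)))"

lemma bipoly_zero: "0 < d \<Longrightarrow> bipoly d (\<lambda>x y. 0)"
  unfolding bipoly_def by (intro exI[of _ "\<lambda>_. 0"]) simp

lemma bipoly_one: "bipoly 1 (\<lambda>x y. 1)"
  unfolding bipoly_def by (intro exI[of _ "\<lambda>_. 1"]) simp

lemma bipoly_add:
  assumes "bipoly d f" "bipoly d g"
  shows "bipoly d (\<lambda>x y. f x y + g x y)"
proof -
  from assms obtain P Q where "\<forall>i. degree (P i) < d" "\<forall>x y. f x y = (\<Sum>i<d. poly (P i) y * x ^ i)"
    "\<forall>i. degree (Q i) < d" "\<forall>x y. g x y = (\<Sum>i<d. poly (Q i) y * x ^ i)"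
    unfolding bipoly_def by blast
  then show ?thesis
    unfolding bipoly_def
    by (intro exI[of _ "\<lambda>i. P i + Q i"]) (simp add: degree_add_less sum.distrib distrib_right)
qed

lemma bipoly_cmult:
  assumes "bipoly d f"
  shows "bipoly d (\<lambda>x y. c * f x y)"
proof -
  from assms obtain P where "\<forall>i. degree (P i) < d" "\<forall>x y. f x y = (\<Sum>i<d. poly (P i) y * x ^ i)"
    unfolding bipoly_def by blast
  then show ?thesis
    unfolding bipoly_def
    by (intro exI[of _ "\<lambda>i. smult c (P i)"])
      (auto simp: sum_distrib_left mult_ac intro: le_less_trans[OF degree_smult_le])
qed

lemma bipoly_sum:
  assumes "0 < d" "\<And>i. i \<in> I \<Longrightarrow> bipoly d (f i)"
  shows "bipoly d (\<lambda>x y. \<Sum>i\<in>I. f i x y)"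
  using assms(2)
proof (induction I rule: infinite_finite_induct)
  case (insert i I)
  then show ?case by (simp add: bipoly_add)
qed (simp_all add: bipoly_zero assms(1))

lemma bipoly_linear_mult:
  assumes "bipoly d f"
  shows "bipoly (Suc d) (\<lambda>x y. (a * x + b * y) * f x y)"
proof -
  from assms obtain P where P: "\<And>i. degree (P i) < d" "\<And>x y. f x y = (\<Sum>i<d. poly (P i) y * x ^ i)"
    unfolding bipoly_def by blast
  \<comment> \<open>Multiplication by \<open>a * x\<close> shifts the coefficients by one place,
    multiplication by \<open>b * y\<close> raises their degree by one. The guard
    \<open>i < d\<close> matters because the sum now includes \<open>i = d\<close>, where
    \<open>P\<close> is uncontrolled.\<close>
  define Q where "Q i = (case i of 0 \<Rightarrow> 0 | Suc j \<Rightarrow> smult a (P j)) + (if i < d then [:0, b:] * P i else 0)" for i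
  have "degree (Q i) < Suc d" for i
  proof -
    have "degree ([:0, b:] * P i) < Suc d"
      using le_less_trans[OF degree_mult_le[of "[:0, b:]" "P i"], of "Suc d"] P(1)[of i]
      by (auto split: if_splits)
    moreover have "degree (smult a (P j)) < Suc d" for j
      using P(1)[of j] degree_smult_le[of a "P j"] by linarith
    ultimately show ?thesis
      unfolding Q_def by (intro degree_add_less) (auto split: nat.splits)
  qed
  moreover have "(a * x + b * y) * f x y = (\<Sum>i<Suc d. poly (Q i) y * x ^ i)" for x y
  proof -
    have "(\<Sum>i<Suc d. poly (Q i) y * x ^ i) =
      (\<Sum>i<Suc d. poly (case i of 0 \<Rightarrow> 0 | Suc j \<Rightarrow> smult a (P j)) y * x ^ i) +
      (\<Sum>i<Suc d. poly (if i < d then [:0, b:] * P i else 0) y * x ^ i)"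
      by (simp only: Q_def poly_add distrib_right sum.distrib)
    also have "(\<Sum>i<Suc d. poly (case i of 0 \<Rightarrow> 0 | Suc j \<Rightarrow> smult a (P j)) y * x ^ i) = a * x * f x y"
      unfolding sum.lessThan_Suc_shift P(2) by (simp add: sum_distrib_left mult_ac)
    also have "(\<Sum>i<Suc d. poly (if i < d then [:0, b:] * P i else 0) y * x ^ i) = b * y * f x y"
      unfolding P(2) by (simp add: sum_distrib_left mult_ac)
    finally show ?thesis by (simp add: distrib_right)
  qed
  ultimately show ?thesis unfolding bipoly_def by blast
qed

text \<open>For \<open>T\<close> the set of all slopes but one, the bound
  \<open>Suc (card T)\<close> is exactly the number of slopes.\<close>

lemma bipoly_prod_linear:
  "finite T \<Longrightarrow> bipoly (Suc (card T)) (\<lambda>x y. \<Prod>s\<in>T. a s * x + b s * y)"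
proof (induction T rule: finite_induct)
  case (insert s T)
  then show ?case by (simp add: bipoly_linear_mult)
qed (use bipoly_one in simp)

section \<open>The boundary curve as a simple closed path\<close>

lemma connected_component_homeomorphism:
  assumes "homeomorphism UNIV UNIV f g"
  shows "connected_component (f ` S) (f x) (f y) \<longleftrightarrow> connected_component S x y"
proof
  have f: "continuous_on UNIV f" and g: "continuous_on UNIV g" and gf: "\<And>x. g (f x) = x"
    using assms by (auto simp: homeomorphism_def)
  show "connected_component (f ` S) (f x) (f y)" if "connected_component S x y"
  proof -
    from that obtain T where "connected T" "T \<subseteq> S" "x \<in> T" "y \<in> T"
      by (auto simp: connected_component_def)
    then show ?thesis
      unfolding connected_component_def
      by (intro exI[of _ "f ` T"])
        (auto intro!: connected_continuous_image continuous_on_subset[OF f])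
  qed
  show "connected_component S x y" if "connected_component (f ` S) (f x) (f y)"
  proof -
    from that obtain T where T: "connected T" "T \<subseteq> f ` S" "f x \<in> T" "f y \<in> T"
      by (auto simp: connected_component_def)
    then have "connected (g ` T)" by (auto intro!: connected_continuous_image continuous_on_subset[OF g])
    moreover have "g ` T \<subseteq> S" "x \<in> g ` T" "y \<in> g ` T"
      using T gf by (auto simp: image_iff) (metis, metis)
    ultimately show ?thesis unfolding connected_component_def by blast
  qed
qed

text \<open>Regions live in \<open>real \<times> real\<close>, while winding numbers and the Jordan
  curve theorem live in \<open>complex\<close>. The map and its inverse are continuous and preserve
  boundedness, so bounded components of the complement correspond.\<close>

lemma inside_bij_linear_image:
  fixes f :: "'a::euclidean_space \<Rightarrow> 'b::euclidean_space"
  assumes "linear f" "bij f"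
  shows "inside (f ` S) = f ` inside S"
proof -
  have gf: "\<And>x. inv f (f x) = x" and fg: "\<And>x. f (inv f x) = x"
    using assms(2) by (simp_all add: bij_is_inj bij_is_surj surj_f_inv_f)
  have lg: "linear (inv f)"
  proof (rule linearI)
    show "inv f (x + y) = inv f x + inv f y" for x y
      using linear_add[OF assms(1), of "inv f x" "inv f y"] gf[of "inv f x + inv f y"] by (simp add: fg)
    show "inv f (c *\<^sub>R x) = c *\<^sub>R inv f x" for c x
      using linear_scale[OF assms(1), of c "inv f x"] gf[of "c *\<^sub>R inv f x"] by (simp add: fg)
  qed
  have hom: "homeomorphism UNIV UNIV f (inv f)"
    using assms lg gf fg 
    by (simp add: homeomorphism_def linear_continuous_on linear_conv_bounded_linear bij_is_surj bij_imp_bij_inv)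
  have compl: "- f ` S = f ` (- S)" using assms(2) by (simp add: bij_image_Compl_eq)
  have comp: "connected_component_set (- f ` S) (f x) = f ` connected_component_set (- S) x" for x
  proof -
    have "y \<in> connected_component_set (- f ` S) (f x) \<longleftrightarrow> inv f y \<in> connected_component_set (- S) x" for y
      using connected_component_homeomorphism[OF hom, of "- S" x "inv f y"] by (simp add: compl fg)
    then show ?thesis
      by (intro set_eqI) (metis (no_types, lifting) fg gf image_iff)
  qed
  have bdd: "bounded (f ` T) \<longleftrightarrow> bounded T" for T
  proof
    assume "bounded (f ` T)"
    then have "bounded (inv f ` f ` T)" using lg linear_conv_bounded_linear bounded_linear_image by blast
    then show "bounded T" by (simp add: image_image gf)
  next
    assume "bounded T"
    then show "bounded (f ` T)" using assms(1) linear_conv_bounded_linear bounded_linear_image by blast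
  qed
  have mem: "f x \<in> inside (f ` S) \<longleftrightarrow> x \<in> inside S" for x
    using bij_is_inj[OF assms(2)] by (simp add: inside_def comp bdd inj_image_mem_iff)
  show ?thesis
  proof (intro set_eqI iffI)
    fix y assume "y \<in> inside (f ` S)"
    then show "y \<in> f ` inside S" using mem[of "inv f y"] fg[of y] by (metis imageI)
  qed (use mem in auto)
qed

section \<open>The polygon as a path in the complex plane\<close>

definition to_complex :: "plane \<Rightarrow> complex" where
  "to_complex v = Complex (fst v) (snd v)"

lemma to_complex_sel [simp]: "Re (to_complex v) = fst v" "Im (to_complex v) = snd v"
  by (simp_all add: to_complex_def)

lemma linear_to_complex: "linear to_complex"
  by (rule linearI) (simp_all add: complex_eq_iff)

lemma to_complex_eq_iff [simp]: "to_complex v = to_complex w \<longleftrightarrow> v = w"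
  by (simp add: complex_eq_iff prod_eq_iff)

lemma bij_to_complex: "bij to_complex"
proof (rule bijI)
  show "inj to_complex" by (simp add: inj_def)
  show "surj to_complex" unfolding surj_def
  proof
    fix z show "\<exists>v. z = to_complex v"
      by (intro exI[of _ "(Re z, Im z)"]) (simp add: complex_eq_iff)
  qed
qed

text \<open>Index \<open>n\<close> means \<open>n + 1\<close> segments, ending at
  \<open>v (Suc n)\<close>; a closed polygon with \<open>n\<close> vertices is therefore the path of
  index \<open>n - 1\<close>.\<close>

primrec polygonal_path :: "(nat \<Rightarrow> complex) \<Rightarrow> nat \<Rightarrow> real \<Rightarrow> complex" where
  "polygonal_path v 0 = linepath (v 0) (v 1)"
| "polygonal_path v (Suc n) = polygonal_path v n +++ linepath (v (Suc n)) (v (Suc (Suc n)))"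

lemma pathstart_polygonal_path [simp]: "pathstart (polygonal_path v n) = v 0"
  by (induction n) simp_all

lemma pathfinish_polygonal_path [simp]: "pathfinish (polygonal_path v n) = v (Suc n)"
  by (cases n) simp_all

lemma path_polygonal_path: "path (polygonal_path v n)"
  by (induction n) simp_all

lemma path_image_polygonal_path:
  "path_image (polygonal_path v n) = (\<Union>j\<le>n. closed_segment (v j) (v (Suc j)))"
  by (induction n) (simp_all add: path_image_join atMost_Suc Un_commute)

lemma winding_number_polygonal_path:
  assumes "z \<notin> path_image (polygonal_path v n)"
  shows "winding_number (polygonal_path v n) z =
    (\<Sum>j\<le>n. winding_number (linepath (v j) (v (Suc j))) z)"
  using assms
  by (induction n)
    (simp_all add: path_image_join winding_number_join path_polygonal_path)

text \<open>Appending an edge keeps the path an arc as long as its endpoint is a new vertex. Only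
  the last edge returns to the start and turns the arc into a loop.\<close>

lemma simple_path_polygonal_path:
  assumes n: "3 \<le> n" and inj: "inj_on v {..<n}" and per: "v n = v 0"
    and meet: "\<And>i j. i < n \<Longrightarrow> j < n \<Longrightarrow> i \<noteq> j \<Longrightarrow>
      closed_segment (v i) (v (Suc i)) \<inter> closed_segment (v j) (v (Suc j)) \<subseteq>
      {v i, v (Suc i)} \<inter> {v j, v (Suc j)}"
  shows "simple_path (polygonal_path v (n - 1))"
proof -
  have neq: "v i \<noteq> v j" if "i < n" "j < n" "i \<noteq> j" for i j
    using inj that by (auto dest: inj_onD)
  \<comment> \<open>The new edge meets the path so far only at their junction, except that the
    closing edge also meets it at the starting vertex.\<close>
  have int: "path_image (polygonal_path v m) \<inter> path_image (linepath (v (Suc m)) (v (Suc (Suc m))))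
      \<subseteq> {v (Suc m)} \<union> (if Suc (Suc m) = n then {v 0} else {})" if "Suc m < n" for m
  proof
    fix z assume "z \<in> path_image (polygonal_path v m) \<inter> path_image (linepath (v (Suc m)) (v (Suc (Suc m))))"
    then obtain j where j: "j \<le> m" "z \<in> closed_segment (v j) (v (Suc j))"
        "z \<in> closed_segment (v (Suc m)) (v (Suc (Suc m)))"
      by (auto simp: path_image_polygonal_path)
    have *: "z \<in> {v j, v (Suc j)}" "z \<in> {v (Suc m), v (Suc (Suc m))}"
      using meet[of j "Suc m"] j that by auto
    show "z \<in> {v (Suc m)} \<union> (if Suc (Suc m) = n then {v 0} else {})"
    proof (cases "Suc (Suc m) = n")
      case True
      with *(2) per show ?thesis by auto
    next
      case False
      then have "v (Suc (Suc m)) \<noteq> v j" "v (Suc (Suc m)) \<noteq> v (Suc j)"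
        using j that neq by simp_all
      with * show ?thesis by auto
    qed
  qed
  have arc: "arc (polygonal_path v m)" if "Suc m < n" for m
    using that
  proof (induction m)
    case 0
    then show ?case using neq[of 0 1] n by simp
  next
    case (Suc m)
    have "arc (linepath (v (Suc m)) (v (Suc (Suc m))))"
      using neq[of "Suc m" "Suc (Suc m)"] Suc.prems by simp
    then show ?case using Suc int[of m] by (auto intro!: arc_join)
  qed
  define m where "m = n - 2"
  have m: "n = Suc (Suc m)" using n by (simp add: m_def)
  have "arc (linepath (v (Suc m)) (v (Suc (Suc m))))"
    using neq[of "Suc m" 0] m per by simp
  then have "simple_path (polygonal_path v (Suc m))"
    using arc[of m] int[of m] m per by (auto intro!: simple_path_join_loop)
  then show ?thesis using m by simp
qed

definition polygon_path :: "plane list \<Rightarrow> real \<Rightarrow> complex" where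
  "polygon_path vs = polygonal_path (to_complex \<circ> vertex vs) (length vs - 1)"

lemma closed_segment_to_complex:
  "closed_segment (to_complex a) (to_complex b) = to_complex ` closed_segment a b"
  by (rule closed_segment_linear_image[OF linear_to_complex])

lemma vertex_length: "vertex vs (length vs) = vertex vs 0"
  by (simp add: vertex_def)

lemma simple_polygon_path:
  assumes "simple_polygon vs"
  shows "simple_path (polygon_path vs)" "pathfinish (polygon_path vs) = pathstart (polygon_path vs)"
    "path_image (polygon_path vs) = to_complex ` boundary_curve vs"
proof -
  let ?n = "length vs" and ?v = "to_complex \<circ> vertex vs"
  from assms have n: "3 \<le> ?n" and d: "distinct vs"
    and meet: "\<And>i j. i < ?n \<Longrightarrow> j < ?n \<Longrightarrow> i \<noteq> j \<Longrightarrow> edge vs i \<inter> edge vs j \<subseteq>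
          {vertex vs i, vertex vs (Suc i)} \<inter> {vertex vs j, vertex vs (Suc j)}"
    by (simp_all add: simple_polygon_def)
  show "simple_path (polygon_path vs)"
    unfolding polygon_path_def
  proof (rule simple_path_polygonal_path[OF n])
    show "inj_on ?v {..<?n}"
      using d by (auto simp: inj_on_def vertex_def nth_eq_iff_index_eq)
    show "?v ?n = ?v 0" by (simp add: vertex_length)
    fix i j assume ij: "i < ?n" "j < ?n" "i \<noteq> j"
    have inj: "inj to_complex" using bij_to_complex bij_is_inj by blast
    show "closed_segment (?v i) (?v (Suc i)) \<inter> closed_segment (?v j) (?v (Suc j)) \<subseteq>
      {?v i, ?v (Suc i)} \<inter> {?v j, ?v (Suc j)}"
      using image_mono[OF meet[OF ij], of to_complex] inj
      by (simp add: closed_segment_to_complex image_Int edge_def)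
  qed
  show "pathfinish (polygon_path vs) = pathstart (polygon_path vs)"
    using n vertex_length[of vs] by (cases "length vs") (simp_all add: polygon_path_def)
  have "{..?n - 1} = {..<?n}" using n by auto
  then show "path_image (polygon_path vs) = to_complex ` boundary_curve vs"
    by (simp add: polygon_path_def path_image_polygonal_path boundary_curve_def edge_def
        closed_segment_to_complex image_UN)
qed

lemma to_complex_polygonal_region:
  assumes "simple_polygon vs"
  shows "to_complex ` polygonal_region vs = inside (path_image (polygon_path vs))"
  using simple_polygon_path(3)[OF assms]
    inside_bij_linear_image[OF linear_to_complex bij_to_complex, of "boundary_curve vs"]
  by (simp add: polygonal_region_def)

section \<open>Winding numbers and ray crossings\<close>

text \<open>The line through \<open>a\<close> and \<open>b\<close> as a graph over the first
  coordinate. For a vertical edge, division by zero gives \<open>snd a\<close>; such edges are told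
  apart by comparing first coordinates.\<close>

definition edge_height :: "plane \<Rightarrow> plane \<Rightarrow> real \<Rightarrow> real" where
  "edge_height a b x = snd a + (x - fst a) * (snd b - snd a) / (fst b - fst a)"

text \<open>Signed intersection of the edge with the upward vertical ray from \<open>z\<close>,
  counted positively when the edge runs from left to right. The strict inequalities make vertical
  edges contribute 0.\<close>

definition crossing :: "plane \<Rightarrow> plane \<Rightarrow> plane \<Rightarrow> real" where
  "crossing a b z =
     (if snd z < edge_height a b (fst z) then
        (if fst a < fst z \<and> fst z < fst b then 1
         else if fst b < fst z \<and> fst z < fst a then -1 else 0)
      else 0)"

lemma closed_segment_edge_height:
  assumes "p \<in> closed_segment a b" "fst a \<noteq> fst b"
  shows "snd p = edge_height a b (fst p)"
proof -
  from assms(1) obtain u where p: "p = (1 - u) *\<^sub>R a + u *\<^sub>R b" by (auto simp: closed_segment_def)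
  have "snd p = snd a + u * (snd b - snd a)" "fst p - fst a = u * (fst b - fst a)"
    unfolding p by (simp_all add: algebra_simps)
  with assms(2) show ?thesis by (simp add: edge_height_def)
qed

lemma closed_segment_fst_between:
  fixes p a b :: plane
  assumes "p \<in> closed_segment a b"
  shows "fst a \<le> fst p \<and> fst p \<le> fst b \<or> fst b \<le> fst p \<and> fst p \<le> fst a"
proof -
  have "fst p \<in> closed_segment (fst a) (fst b)"
    using closed_segment_linear_image[OF bounded_linear.linear[OF bounded_linear_fst], of a b] assms
    by simp
  then show ?thesis by (auto simp: closed_segment_eq_real_ivl split: if_splits)
qed

text \<open>On a segment that avoids the branch cut, \<open>Ln (c * (w - z))\<close> is a primitive
  of \<open>1 / (w - z)\<close>. The factor \<open>c\<close> rotates the cut: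
  \<open>c = \<i>\<close> makes it point upwards from \<open>z\<close>, \<open>c = - \<i>\<close>
  downwards.\<close>

lemma winding_number_linepath_primitive:
  assumes "\<And>w. w \<in> closed_segment a b \<Longrightarrow> c * (w - z) \<notin> \<real>\<^sub>\<le>\<^sub>0" "c \<noteq> 0"
  shows "winding_number (linepath a b) z = (Ln (c * (b - z)) - Ln (c * (a - z))) / (2 * pi * \<i>)"
proof -
  have z: "z \<notin> closed_segment a b" using assms(1)[of z] by auto
  have "((\<lambda>w. 1 / (w - z)) has_contour_integral
      (Ln (c * (pathfinish (linepath a b) - z)) - Ln (c * (pathstart (linepath a b) - z)))) (linepath a b)"
  proof (rule contour_integral_primitive[where S = "closed_segment a b"])
    fix w assume w: "w \<in> closed_segment a b"
    then have "w \<noteq> z" using z by auto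
    then show "((\<lambda>w. Ln (c * (w - z))) has_field_derivative 1 / (w - z)) (at w within closed_segment a b)"
      using assms(1)[OF w] assms(2) by (auto intro!: derivative_eq_intros simp: field_simps)
  qed simp_all
  then show ?thesis
    using z by (simp add: winding_number_valid_path contour_integral_unique)
qed

lemma ii_times_in_nonpos_Reals_iff:
  "\<i> * w \<in> \<real>\<^sub>\<le>\<^sub>0 \<longleftrightarrow> Re w = 0 \<and> 0 \<le> Im w"
  "- \<i> * w \<in> \<real>\<^sub>\<le>\<^sub>0 \<longleftrightarrow> Re w = 0 \<and> Im w \<le> 0"
  by (auto simp: complex_nonpos_Reals_iff)

text \<open>Off the crossings the branch of the logarithm cut along the upward vertical ray is a
  primitive; on a crossing edge the branch cut along the downward ray is, and the two branches
  differ by \<open>\<plusminus> pi * \<i>\<close> in the two half planes.\<close>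

lemma winding_number_edge:
  assumes "fst a \<noteq> fst z" "fst b \<noteq> fst z" "z \<notin> closed_segment a b"
  shows "winding_number (linepath (to_complex a) (to_complex b)) (to_complex z) =
    (Ln (\<i> * (to_complex b - to_complex z)) - Ln (\<i> * (to_complex a - to_complex z))) / (2 * pi * \<i>)
    - of_real (crossing a b z)"
proof (cases "crossing a b z = 0")
  case True
  have "\<i> * (w - to_complex z) \<notin> \<real>\<^sub>\<le>\<^sub>0"
    if w: "w \<in> closed_segment (to_complex a) (to_complex b)" for w
  proof
    assume "\<i> * (w - to_complex z) \<in> \<real>\<^sub>\<le>\<^sub>0"
    moreover obtain p where p: "w = to_complex p" "p \<in> closed_segment a b"
      using w by (auto simp: closed_segment_to_complex)
    ultimately have x: "fst p = fst z" and y: "snd z \<le> snd p"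
      unfolding ii_times_in_nonpos_Reals_iff by auto
    have "fst a \<noteq> fst b" using closed_segment_fst_between[OF p(2)] x assms by auto
    then have "snd p = edge_height a b (fst z)" using closed_segment_edge_height[OF p(2)] x by simp
    moreover have "snd p \<noteq> snd z" using x p assms(3) by (metis prod_eqI)
    ultimately show False
      using True closed_segment_fst_between[OF p(2)] x y assms by (auto simp: crossing_def split: if_splits)
  qed
  then show ?thesis using True by (simp add: winding_number_linepath_primitive[where c = \<i>])
next
  case False
  have lt: "snd z < edge_height a b (fst z)" and
    or: "fst a < fst z \<and> fst z < fst b \<or> fst b < fst z \<and> fst z < fst a"
    using False by (auto simp: crossing_def split: if_splits)
  have "- \<i> * (w - to_complex z) \<notin> \<real>\<^sub>\<le>\<^sub>0"
    if w: "w \<in> closed_segment (to_complex a) (to_complex b)" for w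
  proof
    assume "- \<i> * (w - to_complex z) \<in> \<real>\<^sub>\<le>\<^sub>0"
    moreover obtain p where p: "w = to_complex p" "p \<in> closed_segment a b"
      using w by (auto simp: closed_segment_to_complex)
    ultimately have x: "fst p = fst z" and y: "snd p \<le> snd z"
      unfolding ii_times_in_nonpos_Reals_iff by auto
    have "fst a \<noteq> fst b" using or by auto
    then have "snd p = edge_height a b (fst z)" using closed_segment_edge_height[OF p(2)] x by simp
    with lt y show False by simp
  qed
  then have wn: "winding_number (linepath (to_complex a) (to_complex b)) (to_complex z) =
      (Ln (- \<i> * (to_complex b - to_complex z)) - Ln (- \<i> * (to_complex a - to_complex z))) / (2 * pi * \<i>)"
    by (intro winding_number_linepath_primitive) simp_all
  have Ln: "Ln (- \<i> * (to_complex p - to_complex z)) = Ln (\<i> * (to_complex p - to_complex z))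
      + (if fst z < fst p then - \<i> * pi else \<i> * pi)" if "fst p \<noteq> fst z" for p
    using that Ln_minus[of "\<i> * (to_complex p - to_complex z)"] by (auto simp: complex_eq_iff)
  \<comment> \<open>The endpoints of a crossing edge lie on opposite sides of the vertical line
    through \<open>z\<close>, so their corrections have opposite signs and differ by
    \<open>2 * pi * \<i>\<close> up to sign, one unit of winding.\<close>
  show ?thesis
    unfolding wn Ln[OF assms(1)] Ln[OF assms(2)]
    using or lt by (elim disjE conjE) (simp_all add: crossing_def divide_simps)
qed

text \<open>All edges use the same branch of the logarithm, so its increments telescope to 0 around
  the closed polygon and only the crossings remain.\<close>

lemma winding_number_polygon_path:
  assumes vs: "simple_polygon vs" and z: "z \<notin> boundary_curve vs"
    and gen: "\<And>v. v \<in> set vs \<Longrightarrow> fst v \<noteq> fst z"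
  shows "winding_number (polygon_path vs) (to_complex z) =
    - of_real (\<Sum>j<length vs. crossing (vertex vs j) (vertex vs (Suc j)) z)"
proof -
  have n: "3 \<le> length vs" using vs by (simp add: simple_polygon_def)
  have set: "vertex vs j \<in> set vs" for j
    using n by (auto simp: vertex_def intro!: nth_mem mod_less_divisor)
  define L where "L j = Ln (\<i> * (to_complex (vertex vs j) - to_complex z))" for j
  have "{..length vs - 1} = {..<length vs}" using n by auto
  moreover have "to_complex z \<notin> path_image (polygon_path vs)"
    using z simple_polygon_path(3)[OF vs] by auto
  ultimately have "winding_number (polygon_path vs) (to_complex z) =
      (\<Sum>j<length vs. winding_number
         (linepath (to_complex (vertex vs j)) (to_complex (vertex vs (Suc j)))) (to_complex z))"
    unfolding polygon_path_def by (subst winding_number_polygonal_path) simp_all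
  also have "\<dots> = (\<Sum>j<length vs. (L (Suc j) - L j) / (2 * pi * \<i>)
      - of_real (crossing (vertex vs j) (vertex vs (Suc j)) z))"
    unfolding L_def using z set gen
    by (intro sum.cong refl winding_number_edge) (auto simp: boundary_curve_def edge_def)
  also have "\<dots> = (\<Sum>j<length vs. L (Suc j) - L j) / (2 * pi * \<i>)
      - of_real (\<Sum>j<length vs. crossing (vertex vs j) (vertex vs (Suc j)) z)"
    by (simp only: sum_subtractf of_real_sum flip: sum_divide_distrib)
  also have "(\<Sum>j<length vs. L (Suc j) - L j) = 0"
    by (subst sum_lessThan_telescope) (simp add: L_def vertex_length)
  finally show ?thesis by simp
qed

text \<open>The winding number of a simple closed curve is 0 outside and constantly 1 or -1 inside.
  The unknown orientation survives as one sign \<sigma>, the same for all points.\<close>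

lemma indicator_polygonal_region:
  assumes vs: "simple_polygon vs"
  obtains \<sigma> :: real where "\<sigma> \<in> {1, -1}"
    "\<And>z. z \<notin> boundary_curve vs \<Longrightarrow> (\<And>v. v \<in> set vs \<Longrightarrow> fst v \<noteq> fst z) \<Longrightarrow>
      indicator (polygonal_region vs) z =
      \<sigma> * (\<Sum>j<length vs. crossing (vertex vs j) (vertex vs (Suc j)) z)"
proof -
  let ?\<gamma> = "polygon_path vs"
  note sp = simple_polygon_path[OF vs]
  have inj: "inj to_complex" using bij_to_complex bij_is_inj by blast
  have inside: "to_complex z \<in> inside (path_image ?\<gamma>) \<longleftrightarrow> z \<in> polygonal_region vs" for z
    using to_complex_polygonal_region[OF vs] inj by (metis inj_image_mem_iff)
  obtain s :: real where s: "s \<in> {1, -1}"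
      "\<And>z. z \<in> inside (path_image ?\<gamma>) \<Longrightarrow> winding_number ?\<gamma> z = of_real s"
    using simple_closed_path_winding_number_inside[OF sp(1)] sp(2)
    by (metis insertI1 insertI2 of_real_1 of_real_minus)
  show ?thesis
  \<comment> \<open>The sign flips because the winding number is minus the sum of the
    crossings.\<close>
  proof (rule that[of "- s"])
    show "- s \<in> {1, -1}" using s(1) by auto
    fix z assume z: "z \<notin> boundary_curve vs" and gen: "\<And>v. v \<in> set vs \<Longrightarrow> fst v \<noteq> fst z"
    let ?c = "\<Sum>j<length vs. crossing (vertex vs j) (vertex vs (Suc j)) z"
    have wn: "winding_number ?\<gamma> (to_complex z) = of_real (- ?c)"
      using winding_number_polygon_path[OF vs z gen] by simp
    have off: "to_complex z \<notin> path_image ?\<gamma>" using z sp(3) by auto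
    show "indicator (polygonal_region vs) z = - s * ?c"
    proof (cases "z \<in> polygonal_region vs")
      case True
      then have "s = - ?c" using s(2)[of "to_complex z"] inside wn by (metis of_real_eq_iff)
      with True s(1) show ?thesis by auto
    next
      case False
      then have "to_complex z \<in> outside (path_image ?\<gamma>)"
        using off inside by (auto simp: outside_inside)
      then have "winding_number ?\<gamma> (to_complex z) = 0"
        using sp by (intro winding_number_zero_in_outside simple_path_imp_path) auto
      with wn have "- ?c = 0" by (metis of_real_eq_0_iff)
      with False show ?thesis by simp
    qed
  qed
qed

section \<open>The Fourier transform of a polygonal region\<close>

abbreviation fourier_const :: complex where
  "fourier_const \<equiv> - 2 * of_real pi * \<i>"

definition wave :: "plane \<Rightarrow> plane \<Rightarrow> complex" where
  "wave \<xi> z = exp (fourier_const * of_real (z \<bullet> \<xi>))"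

lemma fourier_wave: "fourier g \<xi> = (\<integral>z. g z * wave \<xi> z \<partial>lborel)"
  by (simp add: fourier_def wave_def)

lemma norm_wave [simp]: "norm (wave \<xi> z) = 1"
  by (simp add: wave_def norm_exp_eq_Re)

lemma continuous_on_wave [continuous_intros]:
  assumes "continuous_on S f" "continuous_on S g"
  shows "continuous_on S (\<lambda>x. wave (f x) (g x))"
  unfolding wave_def using assms by (intro continuous_intros)

lemma wave_measurable [measurable]: "wave \<xi> \<in> borel_measurable borel"
  by (intro borel_measurable_continuous_onI continuous_intros)

section \<open>Fourier transforms of the trapezoids below the edges\<close>

text \<open>Cutting off at height 0 keeps the set bounded, hence its indicator integrable; this fits
  because the regions lie in the upper half plane. Using \<open>closed_segment\<close> makes the set
  insensitive to the direction of a non-vertical edge.\<close>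

definition trapezoid :: "plane \<Rightarrow> plane \<Rightarrow> plane set" where
  "trapezoid a b = {z. fst z \<in> closed_segment (fst a) (fst b) \<and> 0 \<le> snd z \<and> snd z \<le> edge_height a b (fst z)}"

lemma edge_height_commute:
  assumes "fst a \<noteq> fst b"
  shows "edge_height b a x = edge_height a b x"
proof -
  define k where "k = (snd b - snd a) / (fst b - fst a)"
  have "snd b = snd a + (fst b - fst a) * k" using assms by (simp add: k_def)
  moreover have "(snd a - snd b) / (fst a - fst b) = k"
    unfolding k_def by (metis minus_diff_eq minus_divide_divide)
  ultimately show ?thesis
    unfolding edge_height_def times_divide_eq_right[symmetric] k_def[symmetric]
    by (simp add: algebra_simps)
qed

lemma trapezoid_commute: "fst a \<noteq> fst b \<Longrightarrow> trapezoid b a = trapezoid a b"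
  by (simp add: trapezoid_def edge_height_commute closed_segment_commute)

lemma edge_height_in_closed_segment:
  assumes "fst a < fst b" "fst a \<le> x" "x \<le> fst b"
  shows "(x, edge_height a b x) \<in> closed_segment a b"
proof -
  define u where "u = (x - fst a) / (fst b - fst a)"
  have x: "x = (1 - u) * fst a + u * fst b"
  proof -
    have "u * (fst b - fst a) = x - fst a" using assms(1) by (simp add: u_def)
    then show ?thesis by (simp add: algebra_simps)
  qed
  have "edge_height a b x = (1 - u) * snd a + u * snd b"
    unfolding edge_height_def times_divide_eq_left[symmetric] u_def[symmetric]
    by (simp add: algebra_simps)
  moreover have "0 \<le> u" "u \<le> 1" using assms by (simp_all add: u_def)
  ultimately show ?thesis
    using x by (auto simp: closed_segment_def prod_eq_iff intro!: exI[of _ u])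
qed

lemma edge_height_bounds:
  assumes "fst a < fst b" "fst a \<le> x" "x \<le> fst b"
  shows "min (snd a) (snd b) \<le> edge_height a b x" "edge_height a b x \<le> max (snd a) (snd b)"
proof -
  have "edge_height a b x \<in> closed_segment (snd a) (snd b)"
    using imageI[OF edge_height_in_closed_segment[OF assms], of snd]
      closed_segment_linear_image[OF bounded_linear.linear[OF bounded_linear_snd], of a b]
    by simp
  then show "min (snd a) (snd b) \<le> edge_height a b x" "edge_height a b x \<le> max (snd a) (snd b)"
    by (auto simp: closed_segment_eq_real_ivl split: if_splits)
qed

lemma compact_trapezoid:
  assumes "fst a < fst b"
  shows "compact (trapezoid a b)"
proof -
  have "trapezoid a b = {z. fst a \<le> fst z} \<inter> {z. fst z \<le> fst b} \<inter> {z. 0 \<le> snd z} \<inter>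
      {z. snd z \<le> edge_height a b (fst z)}"
    using assms by (auto simp: trapezoid_def closed_segment_eq_real_ivl)
  then have "closed (trapezoid a b)"
    unfolding edge_height_def
    using assms by (auto intro!: closed_Collect_le continuous_intros)
  moreover have "trapezoid a b \<subseteq> cbox (fst a, 0) (fst b, max (snd a) (snd b))"
  proof
    fix z assume "z \<in> trapezoid a b"
    then have "fst a \<le> fst z" "fst z \<le> fst b" "0 \<le> snd z" "snd z \<le> edge_height a b (fst z)"
      using assms by (auto simp: trapezoid_def closed_segment_eq_real_ivl)
    with edge_height_bounds(2)[OF assms this(1,2)]
    show "z \<in> cbox (fst a, 0) (fst b, max (snd a) (snd b))"
      by (cases z) (auto simp: cbox_Pair_eq)
  qed
  ultimately show ?thesis
    using bounded_cbox bounded_subset compact_eq_bounded_closed by blast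
qed

lemma integrable_trapezoid_wave:
  assumes "fst a < fst b"
  shows "integrable lborel (\<lambda>z. indicator (trapezoid a b) z * wave \<xi> z)"
proof -
  have "integrable lborel (\<lambda>z. indicator (trapezoid a b) z *\<^sub>R wave \<xi> z)"
    using compact_trapezoid[OF assms] by (intro borel_integrable_compact continuous_intros)
  then show ?thesis by (simp add: scaleR_conv_of_real of_real_indicator)
qed

lemma integral_exp_Icc:
  fixes p q :: complex
  assumes "l \<le> u" "q \<noteq> 0"
  shows "(\<integral>x. indicator {l..u} x *\<^sub>R exp (p + of_real x * q) \<partial>lborel) =
    (exp (p + of_real u * q) - exp (p + of_real l * q)) / q"
    and "has_bochner_integral lborel (\<lambda>x. indicator {l..u} x *\<^sub>R exp (p + of_real x * q))
    ((exp (p + of_real u * q) - exp (p + of_real l * q)) / q)"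
proof -
  show "has_bochner_integral lborel (\<lambda>x. indicator {l..u} x *\<^sub>R exp (p + of_real x * q))
    ((exp (p + of_real u * q) - exp (p + of_real l * q)) / q)"
    unfolding diff_divide_distrib
  proof (rule has_bochner_integral_FTC_Icc[OF assms(1)])
    show "((\<lambda>x. exp (p + of_real x * q) / q) has_vector_derivative exp (p + of_real x * q))
        (at x within {l..u})" for x
    proof -
      have "((\<lambda>w. exp (p + w * q) / q) has_field_derivative exp (p + of_real x * q)) (at (of_real x))"
        using assms(2) by (auto intro!: derivative_eq_intros)
      then show ?thesis
        by (rule has_vector_derivative_real_field)
    qed
  qed (intro continuous_intros)
  then show "(\<integral>x. indicator {l..u} x *\<^sub>R exp (p + of_real x * q) \<partial>lborel) =
    (exp (p + of_real u * q) - exp (p + of_real l * q)) / q"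
    by (rule has_bochner_integral_integral_eq)
qed

text \<open>Integrating vertically leaves an exponential along the upper edge minus one along the
  base, and both are integrated in closed form horizontally. The edge gives the first term of the
  result; the base gives the second, which depends only on first coordinates.\<close>

lemma fourier_trapezoid:
  assumes ab: "fst a < fst b" and pos: "0 \<le> snd a" "0 \<le> snd b"
    and \<xi>: "fst \<xi> \<noteq> 0" "snd \<xi> \<noteq> 0" "(b - a) \<bullet> \<xi> \<noteq> 0"
  shows "fourier_const\<^sup>2 * of_real (snd \<xi>) * fourier (indicator (trapezoid a b)) \<xi> =
    of_real (fst b - fst a) * (wave \<xi> b - wave \<xi> a) / of_real ((b - a) \<bullet> \<xi>) -
    (exp (fourier_const * of_real (fst b * fst \<xi>)) - exp (fourier_const * of_real (fst a * fst \<xi>)))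
      / of_real (fst \<xi>)"
proof -
  let ?c = fourier_const
  \<comment> \<open>On the line through \<open>a\<close> and \<open>b\<close> the phase is the
    affine function \<open>p + x * m\<close> of the abscissa \<open>x\<close>.\<close>
  define m where "m = ((b - a) \<bullet> \<xi>) / (fst b - fst a)"
  define p where "p = a \<bullet> \<xi> - fst a * m"
  have m: "m \<noteq> 0" using \<xi> ab by (simp add: m_def)
  have line: "x * fst \<xi> + edge_height a b x * snd \<xi> = p + x * m" for x
  proof -
    define k where "k = (snd b - snd a) / (fst b - fst a)"
    have "m = fst \<xi> + k * snd \<xi>"
      using ab by (simp add: m_def k_def inner_prod_def add_divide_distrib)
    then show ?thesis
      unfolding edge_height_def times_divide_eq_right[symmetric] k_def[symmetric]
      by (simp add: p_def inner_prod_def algebra_simps)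
  qed
  have "fourier (indicator (trapezoid a b)) \<xi> =
      (\<integral>x. (\<integral>y. indicator (trapezoid a b) (x, y) * wave \<xi> (x, y) \<partial>lborel) \<partial>lborel)"
    unfolding fourier_wave
    using lborel_pair.integral_fst'[of "\<lambda>z. indicator (trapezoid a b) z * wave \<xi> z"]
      integrable_trapezoid_wave[OF ab] by (simp add: lborel_prod)
  also have "\<dots> = (\<integral>x. indicator {fst a..fst b} x *\<^sub>R
      ((exp (?c * of_real p + of_real x * (?c * of_real m)) - exp (0 + of_real x * (?c * of_real (fst \<xi>)))) /
       (?c * of_real (snd \<xi>))) \<partial>lborel)"
  proof (rule Bochner_Integration.integral_cong[OF refl])
    fix x
    show "(\<integral>y. indicator (trapezoid a b) (x, y) * wave \<xi> (x, y) \<partial>lborel) =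
      indicator {fst a..fst b} x *\<^sub>R
      ((exp (?c * of_real p + of_real x * (?c * of_real m)) - exp (0 + of_real x * (?c * of_real (fst \<xi>)))) /
       (?c * of_real (snd \<xi>)))"
    proof (cases "x \<in> {fst a..fst b}")
      case True
      then have h: "0 \<le> edge_height a b x" using edge_height_bounds(1)[OF ab] pos by fastforce
      have "(\<integral>y. indicator (trapezoid a b) (x, y) * wave \<xi> (x, y) \<partial>lborel) =
        (\<integral>y. indicator {0..edge_height a b x} y *\<^sub>R
          exp (?c * of_real (x * fst \<xi>) + of_real y * (?c * of_real (snd \<xi>))) \<partial>lborel)"
        using True ab
        by (intro Bochner_Integration.integral_cong refl)
          (auto simp: trapezoid_def closed_segment_eq_real_ivl wave_def inner_prod_def algebra_simps
            split: split_indicator)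
      also have "\<dots> = (exp (?c * of_real (x * fst \<xi>) + of_real (edge_height a b x) * (?c * of_real (snd \<xi>)))
          - exp (?c * of_real (x * fst \<xi>) + of_real 0 * (?c * of_real (snd \<xi>)))) / (?c * of_real (snd \<xi>))"
        using h \<xi> by (intro integral_exp_Icc) simp_all
      also have "?c * of_real (x * fst \<xi>) + of_real (edge_height a b x) * (?c * of_real (snd \<xi>)) =
          ?c * of_real (x * fst \<xi> + edge_height a b x * snd \<xi>)"
        by (simp add: algebra_simps)
      also have "\<dots> = ?c * of_real p + of_real x * (?c * of_real m)"
        unfolding line by (simp add: algebra_simps)
      finally show ?thesis using True by (simp add: algebra_simps)
    next
      case False
      with ab have "(x, y) \<notin> trapezoid a b" for y
        by (auto simp: trapezoid_def closed_segment_eq_real_ivl)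
      with False show ?thesis by simp
    qed
  qed
  also have "\<dots> = ((exp (?c * of_real p + of_real (fst b) * (?c * of_real m))
        - exp (?c * of_real p + of_real (fst a) * (?c * of_real m))) / (?c * of_real m)
      - (exp (0 + of_real (fst b) * (?c * of_real (fst \<xi>)))
        - exp (0 + of_real (fst a) * (?c * of_real (fst \<xi>)))) / (?c * of_real (fst \<xi>)))
      / (?c * of_real (snd \<xi>))"
  proof -
    have "has_bochner_integral lborel (\<lambda>x.
        (indicator {fst a..fst b} x *\<^sub>R exp (?c * of_real p + of_real x * (?c * of_real m))
         - indicator {fst a..fst b} x *\<^sub>R exp (0 + of_real x * (?c * of_real (fst \<xi>)))) /
        (?c * of_real (snd \<xi>)))
      (((exp (?c * of_real p + of_real (fst b) * (?c * of_real m))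
        - exp (?c * of_real p + of_real (fst a) * (?c * of_real m))) / (?c * of_real m)
      - (exp (0 + of_real (fst b) * (?c * of_real (fst \<xi>)))
        - exp (0 + of_real (fst a) * (?c * of_real (fst \<xi>)))) / (?c * of_real (fst \<xi>)))
      / (?c * of_real (snd \<xi>)))"
      using ab m \<xi>
      by (intro has_bochner_integral_divide_zero has_bochner_integral_diff integral_exp_Icc(2)) simp_all
    from has_bochner_integral_integral_eq[OF this] show ?thesis
      by (simp add: scaleR_conv_of_real right_diff_distrib)
  qed
  also have "exp (?c * of_real p + of_real (fst a) * (?c * of_real m)) = wave \<xi> a"
    by (simp add: wave_def p_def algebra_simps)
  also have "exp (?c * of_real p + of_real (fst b) * (?c * of_real m)) = wave \<xi> b"
  proof -
    have "(fst b - fst a) * m = (b - a) \<bullet> \<xi>" using ab by (simp add: m_def)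
    then have "p + fst b * m = b \<bullet> \<xi>" by (simp add: p_def algebra_simps inner_diff_left)
    then have "wave \<xi> b = exp (?c * of_real (p + fst b * m))" by (simp add: wave_def)
    then show ?thesis by (simp add: algebra_simps)
  qed
  finally have "?c\<^sup>2 * of_real (snd \<xi>) * fourier (indicator (trapezoid a b)) \<xi> =
     (wave \<xi> b - wave \<xi> a) / of_real m - (exp (0 + of_real (fst b) * (?c * of_real (fst \<xi>)))
        - exp (0 + of_real (fst a) * (?c * of_real (fst \<xi>)))) / of_real (fst \<xi>)"
  proof -
    \<comment> \<open>Abstracting the integrals into variables leaves a purely rational
      identity.\<close>
    have alg: "c\<^sup>2 * s * I = X / m - Y / f"
      if "I = (X / (c * m) - Y / (c * f)) / (c * s)" "c \<noteq> 0" "m \<noteq> 0" "f \<noteq> 0" "s \<noteq> 0"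
      for c s I X Y m f :: complex
      using that by (simp add: field_simps power2_eq_square)
    assume "fourier (indicator (trapezoid a b)) \<xi> = ((wave \<xi> b - wave \<xi> a) / (?c * of_real m)
      - (exp (0 + of_real (fst b) * (?c * of_real (fst \<xi>)))
        - exp (0 + of_real (fst a) * (?c * of_real (fst \<xi>)))) / (?c * of_real (fst \<xi>)))
      / (?c * of_real (snd \<xi>))"
    from alg[OF this] show ?thesis using \<xi> m by simp
  qed
  also have "(wave \<xi> b - wave \<xi> a) / of_real m =
      of_real (fst b - fst a) * (wave \<xi> b - wave \<xi> a) / of_real ((b - a) \<bullet> \<xi>)"
    by (simp add: m_def)
  finally show ?thesis by (simp add: algebra_simps)
qed

section \<open>Null sets, and the sum over the edges\<close>

lemma AE_not_in_hyperplane: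
  fixes a :: "'a::euclidean_space"
  assumes "a \<noteq> 0"
  shows "AE z in lborel. a \<bullet> z \<noteq> c"
proof -
  have "{z. a \<bullet> z = c} \<in> null_sets lebesgue"
    using negligible_hyperplane[of a c] assms by (simp add: negligible_iff_null_sets)
  from AE_not_in[OF this] show ?thesis unfolding AE_completion_iff by simp
qed

lemma AE_fst_neq: "AE z in (lborel :: plane measure). fst z \<noteq> c"
  using AE_not_in_hyperplane[of "(1, 0) :: plane" c] by (simp add: inner_prod_def zero_prod_def)

lemma AE_snd_neq: "AE z in (lborel :: plane measure). snd z \<noteq> c"
  using AE_not_in_hyperplane[of "(0, 1) :: plane" c] by (simp add: inner_prod_def zero_prod_def)

lemma AE_not_in_closed_segment:
  fixes a b :: plane
  assumes "a \<noteq> b"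
  shows "AE z in lborel. z \<notin> closed_segment a b"
proof -
  \<comment> \<open>The vector \<open>b - a\<close> turned by a right angle, that is, a normal of
    the line that contains the segment.\<close>
  define n :: plane where "n = (snd a - snd b, fst b - fst a)"
  have n: "n \<noteq> 0" using assms by (auto simp: n_def prod_eq_iff)
  have "n \<bullet> z = n \<bullet> a" if z: "z \<in> closed_segment a b" for z
  proof -
    obtain u where z: "z = (1 - u) *\<^sub>R a + u *\<^sub>R b"
      using z unfolding closed_segment_def by blast
    show ?thesis unfolding z by (simp add: n_def inner_prod_def algebra_simps)
  qed
  then show ?thesis
    by (intro eventually_mono[OF AE_not_in_hyperplane[OF n, of "n \<bullet> a"]]) blast
qed

text \<open>For generic \<open>z\<close> above the axis, lying below the edge and lying in its
  trapezoid coincide. The sign supplies the direction of the edge and is 0 for a vertical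
  one.\<close>

lemma crossing_trapezoid:
  assumes "z \<notin> closed_segment a b" "fst a \<noteq> fst z" "fst b \<noteq> fst z" "0 < snd z"
  shows "crossing a b z = sgn (fst b - fst a) * indicator (trapezoid a b) z"
proof -
  have *: "z \<in> trapezoid a b \<longleftrightarrow> fst a < fst z \<and> fst z < fst b \<and> snd z < edge_height a b (fst z)"
    if "fst a < fst b" "z \<notin> closed_segment a b" "fst a \<noteq> fst z" "fst b \<noteq> fst z" for a b
  proof -
    have "snd z \<noteq> edge_height a b (fst z)" if "fst a \<le> fst z" "fst z \<le> fst b"
      using edge_height_in_closed_segment[OF \<open>fst a < fst b\<close> that] \<open>z \<notin> closed_segment a b\<close>
      by (metis prod.collapse)
    with that assms(4) show ?thesis
      by (auto simp: trapezoid_def closed_segment_eq_real_ivl)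
  qed
  consider "fst a < fst b" | "fst b < fst a" | "fst a = fst b" by linarith
  then show ?thesis
  proof cases
    case 1
    with *[OF 1] assms show ?thesis by (auto simp: crossing_def indicator_def)
  next
    case 2
    then have "z \<in> trapezoid a b \<longleftrightarrow> fst b < fst z \<and> fst z < fst a \<and> snd z < edge_height a b (fst z)"
      using *[OF 2] assms edge_height_commute[of a b] trapezoid_commute[of a b]
      by (auto simp: closed_segment_commute)
    with 2 show ?thesis by (auto simp: crossing_def indicator_def)
  next
    case 3
    then show ?thesis by (auto simp: crossing_def)
  qed
qed

text \<open>The sign makes the formula valid for every direction of the edge: reversing the edge
  negates both sides, and for a vertical edge both sides are 0.\<close>

lemma fourier_signed_trapezoid:
  assumes pos: "0 \<le> snd a" "0 \<le> snd b"
    and \<xi>: "fst \<xi> \<noteq> 0" "snd \<xi> \<noteq> 0" "(b - a) \<bullet> \<xi> \<noteq> 0"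
  shows "fourier_const\<^sup>2 * of_real (snd \<xi>) *
      (of_real (sgn (fst b - fst a)) * fourier (indicator (trapezoid a b)) \<xi>) =
    of_real (fst b - fst a) * (wave \<xi> b - wave \<xi> a) / of_real ((b - a) \<bullet> \<xi>) -
    (exp (fourier_const * of_real (fst b * fst \<xi>)) - exp (fourier_const * of_real (fst a * fst \<xi>)))
      / of_real (fst \<xi>)"
proof -
  consider "fst a < fst b" | "fst b < fst a" | "fst a = fst b" by linarith
  then show ?thesis
  proof cases
    case 1
    with fourier_trapezoid[OF 1 pos \<xi>] show ?thesis by simp
  next
    case 2
    define d where "d = (b - a) \<bullet> \<xi>"
    have d': "(a - b) \<bullet> \<xi> = - d" by (simp add: d_def inner_diff_left)
    have "d \<noteq> 0" using \<xi> by (simp add: d_def)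
    have alg: "- (of_real (x - y) * (u - v) / of_real (- d) - (p - q) / of_real f) =
        of_real (y - x) * (v - u) / of_real d - (q - p) / of_real f"
      if "f \<noteq> 0" for x y f :: real and u v p q :: complex
      using \<open>d \<noteq> 0\<close> that by (simp add: field_simps)
    have "trapezoid a b = trapezoid b a" using 2 trapezoid_commute[of b a] by simp
    moreover have "sgn (fst b - fst a) = -1" using 2 by simp
    ultimately show ?thesis
      using fourier_trapezoid[OF 2 pos(2,1), of \<xi>] \<xi> \<open>d \<noteq> 0\<close>
        alg[OF \<xi>(1), of "fst a" "fst b" "wave \<xi> a" "wave \<xi> b"]
      unfolding d' d_def[symmetric] by simp
  next
    case 3
    then show ?thesis by simp
  qed
qed

lemma integrable_signed_trapezoid_wave:
  "integrable lborel (\<lambda>z. of_real (sgn (fst b - fst a)) * (indicator (trapezoid a b) z * wave \<xi> z))"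
proof (cases "fst a" "fst b" rule: linorder_cases)
  case greater
  then show ?thesis
    using integrable_trapezoid_wave[OF greater] trapezoid_commute[of b a] by simp
qed (simp_all add: integrable_trapezoid_wave)

lemma polygonal_region_measurable:
  assumes "simple_polygon vs"
  shows "polygonal_region vs \<in> sets borel"
proof -
  have "closed (boundary_curve vs)"
    by (auto simp: boundary_curve_def edge_def intro!: closed_UN)
  then show ?thesis
    unfolding polygonal_region_def by (intro borel_open open_inside)
qed

lemma vertex_in_set: "vs \<noteq> [] \<Longrightarrow> vertex vs j \<in> set vs"
  by (simp add: vertex_def)

lemma simple_polygon_edge_nonzero:
  assumes "simple_polygon vs" "j < length vs"
  shows "vertex vs j \<noteq> vertex vs (Suc j)"
proof -
  have "j mod length vs \<noteq> Suc j mod length vs" "distinct vs" "0 < length vs"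
    using assms by (auto simp: simple_polygon_def mod_Suc)
  then show ?thesis by (simp add: vertex_def nth_eq_iff_index_eq)
qed

text \<open>The base terms of the trapezoids are increments of a function of the vertex, so they
  cancel around the polygon and only the edge terms remain. The sign \<sigma> depends on the polygon
  alone, hence its place before the quantifier over \<xi>.\<close>

lemma fourier_polygonal_region:
  assumes vs: "simple_polygon vs" and sub: "set vs \<subseteq> unit_square" "polygonal_region vs \<subseteq> unit_square"
  shows "\<exists>\<sigma>::real. \<forall>\<xi>. fst \<xi> \<noteq> 0 \<longrightarrow> snd \<xi> \<noteq> 0 \<longrightarrow>
      (\<forall>j<length vs. (vertex vs (Suc j) - vertex vs j) \<bullet> \<xi> \<noteq> 0) \<longrightarrow>
      fourier_const\<^sup>2 * of_real (snd \<xi>) * fourier (indicator (polygonal_region vs)) \<xi> =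
      of_real \<sigma> * (\<Sum>j<length vs. of_real (fst (vertex vs (Suc j)) - fst (vertex vs j)) *
        (wave \<xi> (vertex vs (Suc j)) - wave \<xi> (vertex vs j)) /
        of_real ((vertex vs (Suc j) - vertex vs j) \<bullet> \<xi>))"
proof -
  let ?P = "polygonal_region vs" and ?n = "length vs" and ?v = "vertex vs"
  have ne: "vs \<noteq> []" using vs by (auto simp: simple_polygon_def)
  have pos: "0 \<le> snd (?v j)" for j
    using vertex_in_set[OF ne, of j] sub(1) by (auto simp: unit_square_def)
  obtain \<sigma> :: real where \<sigma>:
    "\<And>z. z \<notin> boundary_curve vs \<Longrightarrow> (\<And>v. v \<in> set vs \<Longrightarrow> fst v \<noteq> fst z) \<Longrightarrow>
      indicator ?P z = \<sigma> * (\<Sum>j<?n. crossing (?v j) (?v (Suc j)) z)"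
    using indicator_polygonal_region[OF vs] by metis
  define s where "s j = sgn (fst (?v (Suc j)) - fst (?v j))" for j
  define T where "T j = trapezoid (?v j) (?v (Suc j))" for j
  \<comment> \<open>Three null sets are discarded: the edges, the vertical lines through the
    vertices, and the horizontal axis.\<close>
  have "AE z in lborel. \<forall>j\<in>{..<?n}. z \<notin> edge vs j"
    unfolding edge_def using simple_polygon_edge_nonzero[OF vs]
    by (intro AE_finite_allI AE_not_in_closed_segment) auto
  moreover have "AE z in (lborel :: plane measure). \<forall>v\<in>set vs. fst z \<noteq> fst v"
    by (rule AE_finite_allI) (simp_all add: AE_fst_neq)
  ultimately have AE: "AE z in lborel. indicator ?P z = \<sigma> * (\<Sum>j<?n. s j * indicator (T j) z)"
    using AE_snd_neq[of 0]
  proof eventually_elim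
    case (elim z)
    have gen: "fst v \<noteq> fst z" if "v \<in> set vs" for v using elim(2) that by force
    show ?case
    proof (cases "0 < snd z")
      case True
      have "indicator ?P z = \<sigma> * (\<Sum>j<?n. crossing (?v j) (?v (Suc j)) z)"
        using elim gen by (intro \<sigma>) (auto simp: boundary_curve_def)
      also have "(\<Sum>j<?n. crossing (?v j) (?v (Suc j)) z) = (\<Sum>j<?n. s j * indicator (T j) z)"
        unfolding s_def T_def using elim True gen vertex_in_set[OF ne]
        by (intro sum.cong refl crossing_trapezoid) (auto simp: edge_def)
      finally show ?thesis .
    next
      case False
      \<comment> \<open>Below the axis there are neither points of the region nor of any
        trapezoid.\<close>
      with elim have "z \<notin> ?P" "z \<notin> T j" for j
        using sub(2) by (auto simp: unit_square_def T_def trapezoid_def)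
      then show ?thesis by simp
    qed
  qed
  have meas: "?P \<in> sets borel" by (rule polygonal_region_measurable[OF vs])
  have int: "integrable lborel (\<lambda>z. of_real (s j) * (indicator (T j) z * wave \<xi> z))" for j \<xi>
    unfolding s_def T_def by (rule integrable_signed_trapezoid_wave)
  have F: "fourier (indicator ?P) \<xi> =
      of_real \<sigma> * (\<Sum>j<?n. of_real (s j) * fourier (indicator (T j)) \<xi>)" for \<xi>
  proof -
    have "fourier (indicator ?P) \<xi> =
        (\<integral>z. of_real \<sigma> * (\<Sum>j<?n. of_real (s j) * (indicator (T j) z * wave \<xi> z)) \<partial>lborel)"
      unfolding fourier_wave
    proof (rule integral_cong_AE)
      show "(\<lambda>z. indicator ?P z * wave \<xi> z) \<in> borel_measurable lborel"
        using meas by measurable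
      show "(\<lambda>z. of_real \<sigma> * (\<Sum>j<?n. of_real (s j) * (indicator (T j) z * wave \<xi> z)))
          \<in> borel_measurable lborel"
        by (rule borel_measurable_times[OF borel_measurable_const
            borel_measurable_sum[OF borel_measurable_integrable[OF int]]])
      show "AE z in lborel. indicator ?P z * wave \<xi> z =
          of_real \<sigma> * (\<Sum>j<?n. of_real (s j) * (indicator (T j) z * wave \<xi> z))"
        using AE
      proof eventually_elim
        case (elim z)
        have "indicator ?P z * wave \<xi> z = of_real (indicator ?P z) * wave \<xi> z"
          by (simp add: of_real_indicator)
        then show ?case
          unfolding elim
          by (simp only: of_real_mult of_real_sum of_real_indicator sum_distrib_right mult.assoc)
      qed
    qed
    also have "\<dots> = of_real \<sigma> * (\<Sum>j<?n. \<integral>z. of_real (s j) * (indicator (T j) z * wave \<xi> z) \<partial>lborel)"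
      by (rule trans[OF integral_mult_right_zero]) (simp only: Bochner_Integration.integral_sum[OF int])
    finally show ?thesis by (simp add: fourier_wave)
  qed
  show ?thesis
  proof (intro exI[of _ \<sigma>] allI impI)
    fix \<xi> :: plane
    assume \<xi>: "fst \<xi> \<noteq> 0" "snd \<xi> \<noteq> 0" "\<forall>j<?n. (?v (Suc j) - ?v j) \<bullet> \<xi> \<noteq> 0"
    define K where "K j = exp (fourier_const * of_real (fst (?v j) * fst \<xi>))" for j
    have "fourier_const\<^sup>2 * of_real (snd \<xi>) * fourier (indicator ?P) \<xi> =
      of_real \<sigma> * (\<Sum>j<?n. fourier_const\<^sup>2 * of_real (snd \<xi>) * (of_real (s j) * fourier (indicator (T j)) \<xi>))"
      by (simp only: F sum_distrib_left mult.assoc mult.left_commute)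
    also have "(\<Sum>j<?n. fourier_const\<^sup>2 * of_real (snd \<xi>) * (of_real (s j) * fourier (indicator (T j)) \<xi>)) =
      (\<Sum>j<?n. of_real (fst (?v (Suc j)) - fst (?v j)) *
        (wave \<xi> (?v (Suc j)) - wave \<xi> (?v j)) / of_real ((?v (Suc j) - ?v j) \<bullet> \<xi>)
        - (K (Suc j) - K j) / of_real (fst \<xi>))"
      unfolding s_def T_def K_def using \<xi> pos
      by (intro sum.cong refl fourier_signed_trapezoid) auto
    also have "\<dots> = (\<Sum>j<?n. of_real (fst (?v (Suc j)) - fst (?v j)) *
        (wave \<xi> (?v (Suc j)) - wave \<xi> (?v j)) / of_real ((?v (Suc j) - ?v j) \<bullet> \<xi>))
        - (\<Sum>j<?n. K (Suc j) - K j) / of_real (fst \<xi>)"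
      by (simp only: sum_subtractf flip: sum_divide_distrib)
    also have "(\<Sum>j<?n. K (Suc j) - K j) = 0"
      by (subst sum_lessThan_telescope) (simp add: K_def vertex_length)
    finally show "fourier_const\<^sup>2 * of_real (snd \<xi>) * fourier (indicator ?P) \<xi> =
      of_real \<sigma> * (\<Sum>j<?n. of_real (fst (?v (Suc j)) - fst (?v j)) *
        (wave \<xi> (?v (Suc j)) - wave \<xi> (?v j)) / of_real ((?v (Suc j) - ?v j) \<bullet> \<xi>))"
      by (simp only: div_0 diff_zero)
  qed
qed

section \<open>Uniqueness of the Fourier transform\<close>

lemma unit_square_subset_cbox: "unit_square \<subseteq> cbox 0 (1, 1)"
  by (auto simp: unit_square_def cbox_Pair_eq zero_prod_def)

lemma emeasure_subset_unit_square:
  assumes "P \<in> sets borel" "P \<subseteq> unit_square"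
  shows "emeasure lborel P < \<infinity>"
proof -
  have "emeasure lborel P \<le> emeasure lborel (cbox (0::plane) (1, 1))"
    using assms unit_square_subset_cbox by (intro emeasure_mono) auto
  also have "\<dots> < \<infinity>" by (rule emeasure_lborel_cbox_finite)
  finally show ?thesis .
qed

lemma integrable_indicator_mult:
  fixes f :: "plane \<Rightarrow> 'b::{banach, second_countable_topology, real_normed_algebra_1}"
  assumes P: "P \<in> sets borel" "P \<subseteq> unit_square" and f: "continuous_on UNIV f"
  shows "integrable lborel (\<lambda>z. indicator P z *\<^sub>R f z)"
proof -
  have "integrable lborel (\<lambda>z. indicator (cbox 0 (1, 1)) z *\<^sub>R f z)"
    using continuous_on_subset[OF f] by (intro borel_integrable_compact) auto
  then have "integrable lborel (\<lambda>z. indicator P z *\<^sub>R (indicator (cbox 0 (1, 1)) z *\<^sub>R f z))"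
    using P(1) by (intro integrable_mult_indicator[of P]) simp_all
  moreover have "indicator P z *\<^sub>R (indicator (cbox 0 (1, 1)) z *\<^sub>R f z) = indicator P z *\<^sub>R f z" for z
    using P(2) unit_square_subset_cbox by (auto split: split_indicator)
  ultimately show ?thesis by (simp only:)
qed

lemma fourier_indicator: "fourier (indicator P) \<xi> = (\<integral>z. indicator P z *\<^sub>R wave \<xi> z \<partial>lborel)"
  by (simp add: fourier_wave scaleR_conv_of_real of_real_indicator)

text \<open>Dominated convergence along sequences, with the indicator of \<open>P\<close> as the
  bound since waves have modulus 1.\<close>

lemma continuous_on_fourier_indicator:
  assumes P: "P \<in> sets borel" "P \<subseteq> unit_square"
  shows "continuous_on UNIV (fourier (indicator P))"
proof (rule continuous_at_imp_continuous_on, rule ballI)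
  fix \<xi> :: plane
  show "isCont (fourier (indicator P)) \<xi>"
    unfolding continuous_at_sequentially
  proof (intro allI impI)
    fix x assume x: "x \<longlonglongrightarrow> \<xi>"
    have "(\<lambda>n. \<integral>z. indicator P z *\<^sub>R wave (x n) z \<partial>lborel) \<longlonglongrightarrow> (\<integral>z. indicator P z *\<^sub>R wave \<xi> z \<partial>lborel)"
    proof (rule integral_dominated_convergence[where w = "indicator P"])
      show "AE z in lborel. (\<lambda>n. indicator P z *\<^sub>R wave (x n) z) \<longlonglongrightarrow> indicator P z *\<^sub>R wave \<xi> z"
        unfolding wave_def using x by (intro AE_I2 tendsto_intros)
      show "integrable lborel (indicat_real P)"
        using emeasure_subset_unit_square[OF P] P(1) by (simp add: integrable_indicator_iff)
    qed (use P in \<open>auto split: split_indicator\<close>)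
    then show "(fourier (indicator P) \<circ> x) \<longlonglongrightarrow> fourier (indicator P) \<xi>"
      by (simp add: fourier_indicator o_def)
  qed
qed

section \<open>Trigonometric polynomials and Stone-Weierstrass approximation\<close>

text \<open>Real parts, because \<open>function_ring_on\<close> concerns real-valued functions; the
  complex factor \<open>w\<close> yields cosines and sines at once. Closure under products is a
  lemma and constants are waves of frequency 0, so a property linear in the function needs to be
  checked only for waves.\<close>

inductive_set trig_polynomials :: "(plane \<Rightarrow> real) set" where
  wave: "(\<lambda>z. Re (w * wave \<xi> z)) \<in> trig_polynomials"
| add: "f \<in> trig_polynomials \<Longrightarrow> g \<in> trig_polynomials \<Longrightarrow> (\<lambda>z. f z + g z) \<in> trig_polynomials"

lemma wave_add: "wave (\<xi> + \<eta>) z = wave \<xi> z * wave \<eta> z"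
  by (simp add: wave_def inner_add_right algebra_simps flip: exp_add)

lemma wave_minus: "wave (- \<xi>) z = cnj (wave \<xi> z)"
  by (simp add: wave_def exp_cnj)

text \<open>The product-to-sum formula: \<open>Re a * Re b\<close> is half of
  \<open>Re (a * b) + Re (a * cnj b)\<close>, and products of waves add or subtract
  frequencies.\<close>

lemma wave_mult_trig_polynomials:
  "(\<lambda>z. Re (w * wave \<xi> z) * Re (v * wave \<eta> z)) \<in> trig_polynomials"
proof -
  have "Re (w * a) * Re (v * b) = Re (w * v / 2 * (a * b)) + Re (w * cnj v / 2 * (a * cnj b))" for a b
    by (simp add: field_simps)
  then have "Re (w * wave \<xi> z) * Re (v * wave \<eta> z) =
      Re (w * v / 2 * wave (\<xi> + \<eta>) z) + Re (w * cnj v / 2 * wave (\<xi> + - \<eta>) z)" for z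
    unfolding wave_add wave_minus .
  then show ?thesis by (simp only:) (intro trig_polynomials.intros)
qed

lemma mult_trig_polynomials:
  assumes "f \<in> trig_polynomials" "g \<in> trig_polynomials"
  shows "(\<lambda>z. f z * g z) \<in> trig_polynomials"
  using assms
proof (induction f)
  case (wave w \<xi>)
  from this show ?case
  proof (induction g)
    case (add f g)
    then show ?case using trig_polynomials.add by (simp add: distrib_left)
  qed (rule wave_mult_trig_polynomials)
next
  case (add f1 f2)
  then show ?case using trig_polynomials.add by (simp add: distrib_right)
qed

lemma continuous_on_trig_polynomials:
  "f \<in> trig_polynomials \<Longrightarrow> continuous_on S f"
  by (induction rule: trig_polynomials.induct) (intro continuous_intros | assumption)+

lemma wave_separates:
  assumes "x \<noteq> y"
  obtains \<xi> where "wave \<xi> x \<noteq> wave \<xi> y"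
proof
  \<comment> \<open>Scaled so that the phases at \<open>x\<close> and \<open>y\<close> differ by a
    quarter turn, which makes the ratio of the two waves \<open>- \<i>\<close>.\<close>
  define \<xi> where "\<xi> = (1 / (4 * ((x - y) \<bullet> (x - y)))) *\<^sub>R (x - y)"
  have "(x - y) \<bullet> \<xi> = 1 / 4" using assms by (simp add: \<xi>_def)
  then have *: "x \<bullet> \<xi> = y \<bullet> \<xi> + 1 / 4" by (simp add: inner_diff_left)
  have "wave \<xi> x = wave \<xi> y * exp (- (of_real pi / 2 * \<i>))"
    unfolding wave_def * by (simp add: algebra_simps flip: exp_add)
  also have "exp (- (of_real pi / 2 * \<i>)) = cis (- (pi / 2))"
    by (simp add: cis_conv_exp mult.commute)
  also have "\<dots> = - \<i>" by (simp add: complex_eq_iff)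
  finally have "wave \<xi> x = wave \<xi> y * - \<i>" .
  moreover have "wave \<xi> y \<noteq> 0" by (simp add: wave_def)
  ultimately show "wave \<xi> x \<noteq> wave \<xi> y" by (auto simp: complex_eq_iff)
qed

lemma function_ring_on_trig_polynomials:
  assumes "compact S"
  shows "function_ring_on trig_polynomials S"
proof
  show "(\<lambda>_. c) \<in> trig_polynomials" for c
    using trig_polynomials.wave[of "of_real c" 0] by (simp add: wave_def)
  show "\<exists>f\<in>trig_polynomials. f x \<noteq> f y" if "x \<noteq> y" for x y
  proof -
    obtain \<xi> where "wave \<xi> x \<noteq> wave \<xi> y" using \<open>x \<noteq> y\<close> by (rule wave_separates)
    \<comment> \<open>Real parts alone may coincide; the factor \<open>- \<i>\<close> turns the
      imaginary part into a real part.\<close>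
    then have "Re (1 * wave \<xi> x) \<noteq> Re (1 * wave \<xi> y) \<or> Re (- \<i> * wave \<xi> x) \<noteq> Re (- \<i> * wave \<xi> y)"
      by (simp add: complex_eq_iff)
    then show ?thesis
      by (elim disjE) (rule bexI[OF _ trig_polynomials.wave], assumption)+
  qed
qed (use assms continuous_on_trig_polynomials trig_polynomials.add mult_trig_polynomials in auto)

lemma integral_indicator_trig_eq:
  assumes P: "P \<in> sets borel" "P \<subseteq> unit_square" and Q: "Q \<in> sets borel" "Q \<subseteq> unit_square"
    and eq: "\<And>\<xi>. fourier (indicator P) \<xi> = fourier (indicator Q) \<xi>"
    and f: "f \<in> trig_polynomials"
  shows "(\<integral>z. indicator P z * f z \<partial>lborel) = (\<integral>z. indicator Q z * f z \<partial>lborel)"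
  using f
proof induction
  case (wave w \<xi>)
  have *: "(\<integral>z. indicator R z * Re (w * wave \<xi> z) \<partial>lborel) = Re (w * fourier (indicator R) \<xi>)"
    if R: "R \<in> sets borel" "R \<subseteq> unit_square" for R
  proof -
    have int: "integrable lborel (\<lambda>z. w * (indicator R z *\<^sub>R wave \<xi> z))"
      using R by (intro integrable_mult_right integrable_indicator_mult continuous_intros)
    have "Re (w * fourier (indicator R) \<xi>) = Re (\<integral>z. w * (indicator R z *\<^sub>R wave \<xi> z) \<partial>lborel)"
      by (simp only: fourier_indicator integral_mult_right_zero)
    also have "\<dots> = (\<integral>z. Re (w * (indicator R z *\<^sub>R wave \<xi> z)) \<partial>lborel)"
      using int by (rule integral_Re[symmetric])
    also have "\<dots> = (\<integral>z. indicator R z * Re (w * wave \<xi> z) \<partial>lborel)"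
      by (intro Bochner_Integration.integral_cong refl)
        (simp only: mult_scaleR_right scaleR_complex.simps)
    finally show ?thesis ..
  qed
  show ?case using *[OF P] *[OF Q] eq by simp
next
  case (add f g)
  have "integrable lborel (\<lambda>z. indicator R z * h z)"
    if "h \<in> trig_polynomials" "R \<in> sets borel" "R \<subseteq> unit_square" for h R
    using integrable_indicator_mult[of R h] that continuous_on_trig_polynomials by simp
  with add P Q show ?case by (simp add: distrib_left)
qed

text \<open>Otherwise a ball inside \<open>P\<close> misses \<open>Q\<close>. A tent function on
  that ball has positive integral over \<open>P\<close> and zero integral over \<open>Q\<close>,
  although it is a uniform limit of trigonometric polynomials, whose integrals over \<open>P\<close>
  and \<open>Q\<close> agree.\<close>

lemma fourier_eq_imp_subset_closure:
  assumes P: "open P" "P \<subseteq> unit_square" and Q: "Q \<in> sets borel" "Q \<subseteq> unit_square"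
    and eq: "\<And>\<xi>. fourier (indicator P) \<xi> = fourier (indicator Q) \<xi>"
  shows "P \<subseteq> closure Q"
proof (rule ccontr)
  assume "\<not> P \<subseteq> closure Q"
  then obtain p where "p \<in> P - closure Q" by blast
  moreover have "open (P - closure Q)" using P by auto
  ultimately obtain e where e: "e > 0" "ball p e \<subseteq> P - closure Q"
    using open_contains_ball by metis
  have Pb: "P \<in> sets borel" using P by auto
  let ?S = "cbox (0::plane) (1, 1)"
  define \<phi> where "\<phi> z = max 0 (e - dist p z)" for z
  define m where "m = measure lborel ?S"
  have cont: "continuous_on A \<phi>" for A
    unfolding \<phi>_def by (intro continuous_intros)
  have int: "integrable lborel (\<lambda>z. indicator R z * h z)"
    if "continuous_on UNIV h" "R \<in> sets borel" "R \<subseteq> unit_square" for R and h :: "plane \<Rightarrow> real"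
    using integrable_indicator_mult[of R h] that by simp
  define K where "K = (\<integral>z. indicator P z * \<phi> z \<partial>lborel)"
  \<comment> \<open>On the ball of half the radius the tent is at least \<open>e / 2\<close>, which
    bounds its integral from below.\<close>
  have "0 < e / 2 * measure lborel (ball p (e / 2))"
    using e content_ball_pos[of "e / 2" p] by simp
  also have "\<dots> = (\<integral>z. e / 2 * indicator (ball p (e / 2)) z \<partial>lborel)" by simp
  also have "\<dots> \<le> K"
    unfolding K_def
  proof (rule integral_mono)
    show "integrable lborel (\<lambda>z. e / 2 * indicator (ball p (e / 2)) z)"
      by (intro integrable_mult_right) (use emeasure_bounded_finite[of "ball p (e / 2)"] in \<open>simp add: integrable_indicator_iff\<close>)
    show "integrable lborel (\<lambda>z. indicator P z * \<phi> z)"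
      using Pb P(2) cont by (intro int)
    show "e / 2 * indicator (ball p (e / 2)) z \<le> indicator P z * \<phi> z" for z
    proof (cases "dist p z < e / 2")
      case True
      then have "z \<in> P" using e by (auto simp: subset_eq)
      moreover have "e / 2 \<le> \<phi> z" using True by (simp add: \<phi>_def le_max_iff_disj)
      ultimately show ?thesis using True by simp
    next
      case False
      then show ?thesis by (simp add: \<phi>_def)
    qed
  qed
  finally have K: "K > 0" .
  have m: "m \<ge> 0" by (simp add: m_def)
  \<comment> \<open>Replacing the tent by its approximation costs at most
    \<open>\<delta> * m\<close> over each of the two sets; the summand 1 makes the total
    \<open>2 * \<delta> * m\<close> strictly less than \<open>K\<close>.\<close>
  define \<delta> where "\<delta> = K / (2 * m + 1)"
  have \<delta>: "\<delta> > 0" using K m by (simp add: \<delta>_def)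
  interpret function_ring_on trig_polynomials ?S
    by (rule function_ring_on_trig_polynomials) simp
  obtain g where g: "g \<in> trig_polynomials" "\<And>z. z \<in> ?S \<Longrightarrow> \<bar>\<phi> z - g z\<bar> < \<delta>"
    using Stone_Weierstrass_basic[OF cont \<delta>] by blast
  have close: "\<bar>(\<integral>z. indicator R z * \<phi> z \<partial>lborel) - (\<integral>z. indicator R z * g z \<partial>lborel)\<bar> \<le> \<delta> * m"
    if R: "R \<in> sets borel" "R \<subseteq> unit_square" for R
  proof -
    have i: "integrable lborel (\<lambda>z. indicator R z * \<phi> z)" "integrable lborel (\<lambda>z. indicator R z * g z)"
      using R cont continuous_on_trig_polynomials[OF g(1)] by (auto intro!: int)
    have "(\<integral>z. indicator R z * \<phi> z \<partial>lborel) - (\<integral>z. indicator R z * g z \<partial>lborel) =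
        (\<integral>z. indicator R z * \<phi> z - indicator R z * g z \<partial>lborel)"
      using i by simp
    also have "\<bar>\<dots>\<bar> \<le> (\<integral>z. \<delta> * indicator ?S z \<partial>lborel)"
    proof (rule order.trans[OF integral_abs_bound integral_mono])
      show "integrable lborel (\<lambda>z. \<bar>indicator R z * \<phi> z - indicator R z * g z\<bar>)" using i by auto
      show "integrable lborel (\<lambda>z. \<delta> * indicator ?S z)"
        by (intro integrable_mult_right) (use emeasure_bounded_finite[of ?S] in \<open>simp add: integrable_indicator_iff\<close>)
      show "\<bar>indicator R z * \<phi> z - indicator R z * g z\<bar> \<le> \<delta> * indicator ?S z" for z
        using g(2)[of z] R(2) unit_square_subset_cbox \<delta> by (auto split: split_indicator)
    qed
    also have "\<dots> = \<delta> * m" by (simp add: m_def)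
    finally show ?thesis .
  qed
  have "(\<integral>z. indicator Q z * \<phi> z \<partial>lborel) = (\<integral>z. 0 \<partial>(lborel :: plane measure))"
  proof (rule Bochner_Integration.integral_cong[OF refl])
    fix z
    have "\<not> dist p z < e" if "z \<in> Q"
      using e(2) closure_subset[of Q] that by (auto simp: subset_eq)
    then show "indicator Q z * \<phi> z = 0"
      by (cases "z \<in> Q") (simp_all add: \<phi>_def)
  qed
  then have "K \<le> 2 * (\<delta> * m)"
    using close[OF Pb P(2)] close[OF Q] integral_indicator_trig_eq[OF Pb P(2) Q eq g(1)]
    by (simp add: K_def)
  also have "\<dots> < K" using K m by (simp add: \<delta>_def field_simps)
  finally show False by simp
qed

text \<open>By the Jordan curve theorem every point of the curve is also a limit of outside points,
  so no curve point is interior to the closure of the inside. This upgrades inclusion in a closure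
  to inclusion in the region.\<close>

lemma interior_closure_polygonal_region:
  assumes "simple_polygon vs"
  shows "interior (closure (polygonal_region vs)) \<subseteq> polygonal_region vs"
proof -
  let ?P = "polygonal_region vs" and ?I = "inside (path_image (polygon_path vs))"
    and ?O = "outside (path_image (polygon_path vs))"
  note J = Jordan_inside_outside[OF simple_polygon_path(1,2)[OF assms]]
  have inj: "inj to_complex" using bij_to_complex bij_is_inj by blast
  have "interior (closure ?I) \<subseteq> ?I"
  proof
    fix z assume z: "z \<in> interior (closure ?I)"
    have cl: "closure ?I \<inter> ?O = {}"
      using J by (metis Int_commute open_Int_closure_eq_empty)
    have "z \<notin> path_image (polygon_path vs)"
    proof
      assume "z \<in> path_image (polygon_path vs)"
      then have "z \<in> closure ?O" using J by (metis DiffD1 frontier_def)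
      moreover have "interior (closure ?I) \<inter> ?O = {}" using cl interior_subset by blast
      ultimately show False
        using z open_Int_closure_eq_empty[OF open_interior, of "closure ?I" ?O] by blast
    qed
    moreover have "z \<notin> ?O" using z cl interior_subset by blast
    ultimately show "z \<in> ?I" using inside_Un_outside by blast
  qed
  moreover have "interior (closure ?I) = to_complex ` interior (closure ?P)"
    unfolding to_complex_polygonal_region[OF assms, symmetric]
    using inj linear_to_complex bij_to_complex
    by (simp add: interior_bijective_linear_image flip: closure_injective_linear_image)
  ultimately show ?thesis
    using inj unfolding to_complex_polygonal_region[OF assms, symmetric] by (auto dest: injD)
qed

lemma fourier_eq_imp_polygonal_region_eq:
  assumes vs: "simple_polygon vs" "polygonal_region vs \<subseteq> unit_square"
    and ws: "simple_polygon ws" "polygonal_region ws \<subseteq> unit_square"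
    and eq: "\<And>\<xi>. fourier (indicator (polygonal_region vs)) \<xi> = fourier (indicator (polygonal_region ws)) \<xi>"
  shows "polygonal_region vs = polygonal_region ws"
proof -
  have "polygonal_region vs \<subseteq> polygonal_region ws"
    if vs: "simple_polygon vs" "polygonal_region vs \<subseteq> unit_square"
    and ws: "simple_polygon ws" "polygonal_region ws \<subseteq> unit_square"
    and eq: "\<And>\<xi>. fourier (indicator (polygonal_region vs)) \<xi> = fourier (indicator (polygonal_region ws)) \<xi>"
    for vs ws
  proof -
    have op: "open (polygonal_region vs)"
      unfolding polygonal_region_def
      by (rule open_inside) (auto simp: boundary_curve_def edge_def intro!: closed_UN)
    have "polygonal_region vs \<subseteq> closure (polygonal_region ws)"
      using fourier_eq_imp_subset_closure[OF op vs(2) polygonal_region_measurable[OF ws(1)] ws(2) eq] .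
    then have "polygonal_region vs \<subseteq> interior (closure (polygonal_region ws))"
      using op by (rule interior_maximal)
    with interior_closure_polygonal_region[OF ws(1)] show ?thesis by blast
  qed
  from this[OF vs ws eq] this[OF ws vs eq[symmetric]] show ?thesis by blast
qed

section \<open>The exponential polynomial of a polygonal region\<close>

lemma continuous_on_bipoly:
  assumes "bipoly d f" "continuous_on S g" "continuous_on S h"
  shows "continuous_on S (\<lambda>x. f (g x) (h x))"
proof -
  from assms(1) obtain P where "\<And>x y. f x y = (\<Sum>i<d. poly (P i) y * x ^ i)"
    unfolding bipoly_def by blast
  then show ?thesis using assms(2,3) by (simp only:) (intro continuous_intros)
qed

text \<open>The disagreement set is open and lies in a null set, hence is empty. This removes the
  conditions that the linear forms be nonzero, which integer samples may violate.\<close>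

lemma continuous_eq_off_hyperplanes:
  fixes f g :: "'a::euclidean_space \<Rightarrow> 'b::t2_space"
  assumes "finite F" "0 \<notin> F" "continuous_on UNIV f" "continuous_on UNIV g"
    and eq: "\<And>x. (\<And>n. n \<in> F \<Longrightarrow> n \<bullet> x \<noteq> 0) \<Longrightarrow> f x = g x"
  shows "f x = g x"
proof -
  have "open {x. f x \<noteq> g x}"
    using assms(3,4) by (rule open_Collect_neq)
  moreover have "negligible (\<Union>n\<in>F. {x. n \<bullet> x = 0})"
    using assms(1,2) by (intro negligible_Union) (auto intro!: negligible_hyperplane)
  then have "negligible {x. f x \<noteq> g x}"
    by (rule negligible_subset) (use eq in blast)
  ultimately show ?thesis using open_not_negligible by blast
qed

lemma unit_vector_neq_0: "(1, 0) \<noteq> (0::plane)" "(0, 1) \<noteq> (0::plane)"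
  by (simp_all add: zero_prod_def)

lemma sum_of_bool_eq:
  fixes f :: "'a \<Rightarrow> 'b::semiring_1"
  assumes "finite V" "a \<in> V"
  shows "(\<Sum>v\<in>V. of_bool (v = a) * f v) = f a"
proof -
  have "(\<Sum>v\<in>V. of_bool (v = a) * f v) = (\<Sum>v\<in>V. if v = a then f v else 0)"
    by (intro sum.cong refl) simp
  with assms show ?thesis by simp
qed

text \<open>\<open>S\<close> and \<open>V\<close> may exceed the slopes and vertices of this
  polygon, so that two polygons can share the same multiplier and the same frequencies. Each edge
  vector is a multiple of the generator of its slope; the multiple cancels between numerator and
  denominator, and the forms of the other slopes remain.\<close>

lemma polygon_exponential_polynomial:
  assumes vs: "simple_polygon vs" and sub: "set vs \<subseteq> unit_square" "polygonal_region vs \<subseteq> unit_square"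
    and S: "finite S" "slopes vs \<subseteq> S" and u: "\<And>s. s \<in> S \<Longrightarrow> s = span {u s}" "\<And>s. s \<in> S \<Longrightarrow> u s \<noteq> 0"
    and V: "finite V" "set vs \<subseteq> V"
  obtains q where "\<And>v. bipoly (card S) (q v)"
    "\<And>\<xi>. fourier_const\<^sup>2 * of_real (snd \<xi>) * (\<Prod>s\<in>S. of_real (u s \<bullet> \<xi>)) *
        fourier (indicator (polygonal_region vs)) \<xi> =
      (\<Sum>v\<in>V. q v (of_real (fst \<xi>)) (of_real (snd \<xi>)) * wave \<xi> v)"
proof -
  let ?P = "polygonal_region vs" and ?n = "length vs" and ?v = "vertex vs"
  have cont: "continuous_on UNIV (fourier (indicator ?P))"
    using sub(2) polygonal_region_measurable[OF vs] by (intro continuous_on_fourier_indicator)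
  have ne: "vs \<noteq> []" using vs by (auto simp: simple_polygon_def)
  have sS: "slope vs j \<in> S" if "j < ?n" for j using S(2) that by (auto simp: slopes_def)
  then have cardS: "0 < card S" using S(1) ne by (auto simp: card_gt_0_iff)
  obtain \<sigma> :: real where F: "\<forall>\<xi>. fst \<xi> \<noteq> 0 \<longrightarrow> snd \<xi> \<noteq> 0 \<longrightarrow>
      (\<forall>j<?n. (?v (Suc j) - ?v j) \<bullet> \<xi> \<noteq> 0) \<longrightarrow>
      fourier_const\<^sup>2 * of_real (snd \<xi>) * fourier (indicator ?P) \<xi> =
      of_real \<sigma> * (\<Sum>j<?n. of_real (fst (?v (Suc j)) - fst (?v j)) *
        (wave \<xi> (?v (Suc j)) - wave \<xi> (?v j)) / of_real ((?v (Suc j) - ?v j) \<bullet> \<xi>))"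
    using fourier_polygonal_region[OF vs sub] ..
  have "\<exists>c. ?v (Suc j) - ?v j = c *\<^sub>R u (slope vs j)" if "j < ?n" for j
  proof -
    have "?v (Suc j) - ?v j \<in> slope vs j" unfolding slope_def by (rule span_base) simp
    then show ?thesis using u(1)[OF sS[OF that]] by (auto simp: span_singleton)
  qed
  then have "\<forall>j\<in>{..<?n}. \<exists>c. ?v (Suc j) - ?v j = c *\<^sub>R u (slope vs j)" by blast
  from bchoice[OF this] obtain c
    where c: "\<And>j. j < ?n \<Longrightarrow> ?v (Suc j) - ?v j = c j *\<^sub>R u (slope vs j)" by blast
  have c0: "c j \<noteq> 0" if "j < ?n" for j
    using c[OF that] simple_polygon_edge_nonzero[OF vs that] by auto
  define R where "R j x y = (\<Prod>s\<in>S - {slope vs j}. of_real (fst (u s)) * x + of_real (snd (u s)) * y)"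
    for j and x y :: complex
  have R: "bipoly (card S) (R j)" if "j < ?n" for j
  proof -
    have "Suc (card (S - {slope vs j})) = card S" 
      using S(1) sS[OF that] by (rule card_Suc_Diff1)
    moreover have "bipoly (Suc (card (S - {slope vs j}))) (R j)"
      unfolding R_def[abs_def] using S(1) by (intro bipoly_prod_linear) simp
    ultimately show ?thesis by simp
  qed
  \<comment> \<open>Regrouping by vertices: an edge contributes positively at its end and negatively
    at its start. Points of \<open>V\<close> that are not vertices of this polygon get coefficient
    0.\<close>
  define q where "q v x y = (\<Sum>j<?n. (of_real \<sigma> * of_real (fst (u (slope vs j))) *
      (of_bool (v = ?v (Suc j)) - of_bool (v = ?v j))) * R j x y)" for v x y
  have q: "bipoly (card S) (q v)" for v
    unfolding q_def[abs_def] using cardS R by (intro bipoly_sum bipoly_cmult) auto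
  have sum_q: "(\<Sum>v\<in>V. q v (of_real (fst \<xi>)) (of_real (snd \<xi>)) * wave \<xi> v) =
    of_real \<sigma> * (\<Sum>j<?n. of_real (fst (u (slope vs j))) * R j (of_real (fst \<xi>)) (of_real (snd \<xi>)) *
      (wave \<xi> (?v (Suc j)) - wave \<xi> (?v j)))" for \<xi>
  proof -
    have V_sum: "(\<Sum>v\<in>V. (of_bool (v = ?v (Suc j)) - of_bool (v = ?v j)) * wave \<xi> v) =
        wave \<xi> (?v (Suc j)) - wave \<xi> (?v j)" for j
    proof -
      have "?v i \<in> V" for i using vertex_in_set[OF ne] V(2) by blast
      then show ?thesis using V(1) 
        unfolding left_diff_distrib sum_subtractf by (simp only: sum_of_bool_eq)
    qed
    have "(\<Sum>v\<in>V. q v (of_real (fst \<xi>)) (of_real (snd \<xi>)) * wave \<xi> v) =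
      (\<Sum>j<?n. \<Sum>v\<in>V. of_real \<sigma> * of_real (fst (u (slope vs j))) * R j (of_real (fst \<xi>)) (of_real (snd \<xi>)) *
        ((of_bool (v = ?v (Suc j)) - of_bool (v = ?v j)) * wave \<xi> v))"
      unfolding q_def sum_distrib_right by (subst sum.swap) (simp only: mult_ac)
    also have "\<dots> = (\<Sum>j<?n. of_real \<sigma> * of_real (fst (u (slope vs j))) * R j (of_real (fst \<xi>)) (of_real (snd \<xi>)) *
      (wave \<xi> (?v (Suc j)) - wave \<xi> (?v j)))"
      by (simp only: V_sum flip: sum_distrib_left)
    finally show ?thesis by (simp only: sum_distrib_left mult_ac)
  qed
  \<comment> \<open>Normals of the hyperplanes on which a denominator may vanish: the two axes and
    one line for each slope.\<close>
  define G where "G = insert (1, 0) (insert (0, 1) (u ` S))"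
  have main: "fourier_const\<^sup>2 * of_real (snd \<xi>) * (\<Prod>s\<in>S. of_real (u s \<bullet> \<xi>)) * fourier (indicator ?P) \<xi> =
      (\<Sum>v\<in>V. q v (of_real (fst \<xi>)) (of_real (snd \<xi>)) * wave \<xi> v)" for \<xi>
  proof (rule continuous_eq_off_hyperplanes[where F = G])
    show "finite G" "0 \<notin> G" using S(1) u(2) by (auto simp: G_def unit_vector_neq_0)
    show "continuous_on UNIV (\<lambda>\<xi>. fourier_const\<^sup>2 * of_real (snd \<xi>) * (\<Prod>s\<in>S. of_real (u s \<bullet> \<xi>)) *
        fourier (indicator ?P) \<xi>)"
      by (intro continuous_intros cont)
    show "continuous_on UNIV (\<lambda>\<xi>. \<Sum>v\<in>V. q v (of_real (fst \<xi>)) (of_real (snd \<xi>)) * wave \<xi> v)"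
      by (intro continuous_on_sum continuous_on_mult continuous_on_bipoly[OF q] continuous_intros)
    fix \<xi> assume gen: "\<And>n. n \<in> G \<Longrightarrow> n \<bullet> \<xi> \<noteq> 0"
    have \<xi>: "fst \<xi> \<noteq> 0" "snd \<xi> \<noteq> 0" "\<And>s. s \<in> S \<Longrightarrow> u s \<bullet> \<xi> \<noteq> 0"
      using gen[of "(1, 0)"] gen[of "(0, 1)"] gen[of "u _"] by (simp_all add: G_def inner_prod_def)
    have "(\<Prod>s\<in>S. of_real (u s \<bullet> \<xi>)) * (of_real (fst (?v (Suc j)) - fst (?v j)) *
        (wave \<xi> (?v (Suc j)) - wave \<xi> (?v j)) / of_real ((?v (Suc j) - ?v j) \<bullet> \<xi>)) =
      of_real (fst (u (slope vs j))) * R j (of_real (fst \<xi>)) (of_real (snd \<xi>)) *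
      (wave \<xi> (?v (Suc j)) - wave \<xi> (?v j))" if j: "j < ?n" for j
    proof -
      let ?s = "slope vs j"
      have "(\<Prod>s\<in>S. of_real (u s \<bullet> \<xi>) :: complex) = of_real (u ?s \<bullet> \<xi>) * (\<Prod>s\<in>S - {?s}. of_real (u s \<bullet> \<xi>))"
        using S(1) sS[OF j] by (rule prod.remove)
      also have "(\<Prod>s\<in>S - {?s}. of_real (u s \<bullet> \<xi>)) = R j (of_real (fst \<xi>)) (of_real (snd \<xi>))"
        by (simp add: R_def inner_prod_def)
      finally have 1: "(\<Prod>s\<in>S. of_real (u s \<bullet> \<xi>) :: complex) =
        of_real (u ?s \<bullet> \<xi>) * R j (of_real (fst \<xi>)) (of_real (snd \<xi>))" .
      have 2: "fst (?v (Suc j)) - fst (?v j) = c j * fst (u ?s)"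
        using arg_cong[OF c[OF j], of fst] by simp
      have 3: "(?v (Suc j) - ?v j) \<bullet> \<xi> = c j * (u ?s \<bullet> \<xi>)"
        by (simp add: c[OF j])
      show ?thesis unfolding 1 2 3 using c0[OF j] \<xi>(3)[OF sS[OF j]] by simp
    qed
    note edge_term = this
    have edges: "\<forall>j<?n. (?v (Suc j) - ?v j) \<bullet> \<xi> \<noteq> 0"
      using c c0 \<xi>(3) sS by simp
    have "fourier_const\<^sup>2 * of_real (snd \<xi>) * (\<Prod>s\<in>S. of_real (u s \<bullet> \<xi>)) * fourier (indicator ?P) \<xi> =
      (\<Prod>s\<in>S. of_real (u s \<bullet> \<xi>)) * (fourier_const\<^sup>2 * of_real (snd \<xi>) * fourier (indicator ?P) \<xi>)"
      by (simp only: mult_ac)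
    also have "\<dots> = of_real \<sigma> * (\<Sum>j<?n. (\<Prod>s\<in>S. of_real (u s \<bullet> \<xi>)) * (of_real (fst (?v (Suc j)) - fst (?v j)) *
        (wave \<xi> (?v (Suc j)) - wave \<xi> (?v j)) / of_real ((?v (Suc j) - ?v j) \<bullet> \<xi>)))"
    proof -
      have "fourier_const\<^sup>2 * of_real (snd \<xi>) * fourier (indicator ?P) \<xi> =
        of_real \<sigma> * (\<Sum>j<?n. of_real (fst (?v (Suc j)) - fst (?v j)) *
        (wave \<xi> (?v (Suc j)) - wave \<xi> (?v j)) / of_real ((?v (Suc j) - ?v j) \<bullet> \<xi>))"
        by (rule F[THEN spec, THEN mp, THEN mp, THEN mp, OF \<xi>(1,2) edges])
      then show ?thesis by (simp only: mult.left_commute flip: sum_distrib_left)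
    qed
    also have "\<dots> = of_real \<sigma> * (\<Sum>j<?n. of_real (fst (u (slope vs j))) * R j (of_real (fst \<xi>)) (of_real (snd \<xi>)) *
      (wave \<xi> (?v (Suc j)) - wave \<xi> (?v j)))"
      using edge_term by simp
    finally show "fourier_const\<^sup>2 * of_real (snd \<xi>) * (\<Prod>s\<in>S. of_real (u s \<bullet> \<xi>)) * fourier (indicator ?P) \<xi> =
      (\<Sum>v\<in>V. q v (of_real (fst \<xi>)) (of_real (snd \<xi>)) * wave \<xi> v)"
      by (simp only: sum_q)
  qed
  show ?thesis using that[OF q main] .
qed

section \<open>The sample set\<close>

text \<open>The bound \<open>ln x \<le> x - 1\<close> at \<open>x = n / (n + 1)\<close> shows that
  each summand is at most the increment of the logarithm.\<close>

lemma sum_inverse_le_ln: "1 \<le> n \<Longrightarrow> (\<Sum>r=1..n. 1 / real r) \<le> 1 + ln (real n)"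
proof (induction n rule: dec_induct)
  case (step n)
  have "ln (real n / real (Suc n)) \<le> real n / real (Suc n) - 1"
    using step.hyps by (intro ln_le_minus_one) simp
  also have "\<dots> = - (1 / real (Suc n))" by (simp add: field_simps)
  finally have "1 / real (Suc n) \<le> ln (real (Suc n)) - ln (real n)"
    using step.hyps by (simp add: ln_div)
  with step show ?case by simp
qed simp

text \<open>Cut the second coordinate into bands of height \<open>2 * (2 * k - 1)\<close>: in the band of index
  \<open>r\<close> only the rectangles of index at least \<open>r\<close> contribute.\<close>

lemma sample_set_subset_bands:
  "sample_set k N \<subseteq> (\<Union>r\<in>{1..2 * N}. {0..2 * \<lfloor>4 * real N / real r\<rfloor> * (2 * int k - 1)} \<times>
     {2 * (int r - 1) * (2 * int k - 1)..2 * int r * (2 * int k - 1)})"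
proof
  fix x assume "x \<in> sample_set k N"
  then obtain m n r where x: "x = (m, n)" and r: "1 \<le> r" "r \<le> 2 * N"
    and m: "0 \<le> m" "m \<le> 2 * \<lfloor>4 * real N / real r\<rfloor> * (2 * int k - 1)"
    and n: "0 \<le> n" "n \<le> 2 * int r * (2 * int k - 1)"
    by (auto simp: sample_set_def)
  \<comment> \<open>The band of the point is given by the least index \<open>s\<close> whose
    rectangle is tall enough; minimality gives the lower edge of the band.\<close>
  define Q where "Q r \<longleftrightarrow> 1 \<le> r \<and> n \<le> 2 * int r * (2 * int k - 1)" for r
  define s where "s = (LEAST r. Q r)"
  have "Q r" using r n by (simp add: Q_def)
  then have s: "Q s" "s \<le> r" unfolding s_def by (rule LeastI, rule Least_le)
  have "0 \<le> 2 * int r * (2 * int k - 1)" using n by linarith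
  then have k: "0 \<le> 2 * int k - 1" using r by (simp add: zero_le_mult_iff)
  have low: "2 * (int s - 1) * (2 * int k - 1) \<le> n"
  proof (cases "s = 1")
    case True
    with n show ?thesis by simp
  next
    case False
    moreover have "1 \<le> s" using s(1) by (simp add: Q_def)
    ultimately have "1 \<le> s - 1" by linarith
    moreover have "\<not> Q (s - 1)"
      using not_less_Least[of "s - 1" Q] \<open>1 \<le> s - 1\<close> unfolding s_def[symmetric] by simp
    ultimately have "2 * int (s - 1) * (2 * int k - 1) < n" by (simp add: Q_def)
    then show ?thesis using \<open>1 \<le> s - 1\<close> by (simp add: of_nat_diff)
  qed
  \<comment> \<open>Rectangles of smaller index are wider, so the point still lies within the width
    for \<open>s\<close>.\<close>
  have "\<lfloor>4 * real N / real r\<rfloor> \<le> \<lfloor>4 * real N / real s\<rfloor>"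
    using s by (intro floor_mono divide_left_mono) (auto simp: Q_def)
  then have "2 * \<lfloor>4 * real N / real r\<rfloor> * (2 * int k - 1) \<le> 2 * \<lfloor>4 * real N / real s\<rfloor> * (2 * int k - 1)"
    using k by (intro mult_right_mono) auto
  then show "x \<in> (\<Union>r\<in>{1..2 * N}. {0..2 * \<lfloor>4 * real N / real r\<rfloor> * (2 * int k - 1)} \<times>
     {2 * (int r - 1) * (2 * int k - 1)..2 * int r * (2 * int k - 1)})"
    using x m low s r by (auto simp: Q_def intro!: bexI[of _ s])
qed

text \<open>Every rectangle has order \<open>k^2 * N\<close> points, so adding their sizes would
  give \<open>N^2\<close>. The band of index \<open>r\<close> has only order
  \<open>k^2 * N / r\<close>, and the harmonic sum produces the logarithm.\<close>

lemma card_sample_set_le: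
  assumes "2 \<le> k" "3 \<le> N"
  shows "real (card (sample_set k N)) \<le> 204 * real k ^ 2 * real N * ln (real N)"
proof -
  let ?B = "\<lambda>r. {0..2 * \<lfloor>4 * real N / real r\<rfloor> * (2 * int k - 1)} \<times>
     {2 * (int r - 1) * (2 * int k - 1)..2 * int r * (2 * int k - 1)}"
  \<comment> \<open>Here 68 is \<open>17 * 4\<close>: the width is at most
    \<open>16 * N * k / r + 1\<close>, with the 1 absorbed as another \<open>N * k / r\<close>
    because \<open>r \<le> 2 * N \<le> k * N\<close>, and the height is
    \<open>4 * k - 1\<close>.\<close>
  have band: "real (card (?B r)) \<le> 68 * real k ^ 2 * real N * (1 / real r)" if r: "r \<in> {1..2 * N}" for r
  proof -
    have "0 \<le> 2 * \<lfloor>4 * real N / real r\<rfloor> * (2 * int k - 1)" using assms by simp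
    then have "real (card {0..2 * \<lfloor>4 * real N / real r\<rfloor> * (2 * int k - 1)}) =
        2 * real_of_int \<lfloor>4 * real N / real r\<rfloor> * (2 * real k - 1) + 1"
      unfolding card_atLeastAtMost_int by (subst of_nat_nat) auto
    also have "\<dots> \<le> 2 * (4 * real N / real r) * (2 * real k) + 1"
      using assms by (intro add_right_mono mult_mono) auto
    also have "1 \<le> real N * real k / real r"
    proof -
      have "real r \<le> real N * 2" using r by auto
      also have "\<dots> \<le> real N * real k" using assms by (intro mult_left_mono) auto
      finally show ?thesis using r by simp
    qed
    finally have 1: "real (card {0..2 * \<lfloor>4 * real N / real r\<rfloor> * (2 * int k - 1)}) \<le> 17 * real N * real k / real r"
      by (simp add: field_simps)
    have "card {2 * (int r - 1) * (2 * int k - 1)..2 * int r * (2 * int k - 1)} = nat (2 * (2 * int k - 1) + 1)"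
      by (simp add: algebra_simps)
    then have 2: "real (card {2 * (int r - 1) * (2 * int k - 1)..2 * int r * (2 * int k - 1)}) \<le> 4 * real k"
      using assms by simp
    have "real (card (?B r)) \<le> (17 * real N * real k / real r) * (4 * real k)"
      unfolding card_cartesian_product of_nat_mult using 1 2 by (intro mult_mono) auto
    then show ?thesis by (simp add: power2_eq_square algebra_simps)
  qed
  have lnN: "1 \<le> ln (real N)"
  proof -
    have "exp 1 \<le> real N" using exp_le assms(2) by linarith
    then show ?thesis using assms(2) by (subst ln_ge_iff) auto
  qed
  have "real (card (sample_set k N)) \<le> real (card (\<Union>r\<in>{1..2 * N}. ?B r))"
    using card_mono[OF _ sample_set_subset_bands[of k N]] by (simp only: of_nat_le_iff) auto
  also have "\<dots> \<le> real (\<Sum>r\<in>{1..2 * N}. card (?B r))"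
    by (intro of_nat_mono card_UN_le) simp
  also have "\<dots> = (\<Sum>r\<in>{1..2 * N}. real (card (?B r)))" by (rule of_nat_sum)
  also have "\<dots> \<le> (\<Sum>r\<in>{1..2 * N}. 68 * real k ^ 2 * real N * (1 / real r))"
    by (rule sum_mono) (rule band)
  also have "\<dots> = 68 * real k ^ 2 * real N * (\<Sum>r=1..2 * N. 1 / real r)"
    by (simp only: sum_distrib_left)
  \<comment> \<open>The sum is at most \<open>1 + ln 2 + ln N\<close>, and both 1 and
    \<open>ln 2\<close> are at most \<open>ln N\<close> since \<open>N \<ge> 3\<close>; so 204 is
    \<open>3 * 68\<close>.\<close>
  also have "(\<Sum>r=1..2 * N. 1 / real r) \<le> 3 * ln (real N)"
  proof -
    have "(\<Sum>r=1..2 * N. 1 / real r) \<le> 1 + ln (real (2 * N))"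
      using assms by (intro sum_inverse_le_ln) simp
    also have "ln (real (2 * N)) = ln 2 + ln (real N)" using assms by (simp add: ln_mult)
    also have "ln 2 \<le> (1::real)" using ln_2_less_1 by simp
    finally show ?thesis using lnN by simp
  qed
  finally show ?thesis by (simp add: mult_left_mono)
qed

section \<open>Determination by the samples\<close>

text \<open>Equal exponentials mean that \<open>x\<close> and \<open>y\<close> differ by an integer.
  Half-openness enters here: 0 and 1 would be indistinguishable at integer samples.\<close>

lemma exp_fourier_const_inj:
  assumes "0 \<le> x" "x < 1" "0 \<le> y" "y < 1"
    and "exp (fourier_const * of_real x) = exp (fourier_const * of_real y)"
  shows "x = y"
proof -
  obtain n :: int where "fourier_const * of_real x = fourier_const * of_real y + (of_int (2 * n) * pi) * \<i>"
    using assms(5) unfolding exp_eq by blast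
  then have "- 2 * pi * x = - 2 * pi * y + 2 * of_int n * pi"
    by (simp add: complex_eq_iff)
  then have "pi * (x + of_int n) = pi * y" by (simp add: algebra_simps)
  then have "x + of_int n = y" by simp
  then have "of_int n < (1::real)" "of_int n > (-1::real)" using assms by linarith+
  then have "n = 0" by linarith
  with \<open>x + of_int n = y\<close> show ?thesis by simp
qed

lemma wave_of_nat:
  "wave (of_nat m, of_nat n) v =
    exp (fourier_const * of_real (fst v)) ^ m * exp (fourier_const * of_real (snd v)) ^ n"
  by (simp add: wave_def inner_prod_def algebra_simps flip: exp_of_nat_mult exp_add)

text \<open>At integer points a wave is a product of powers of the two coordinate exponentials of
  the vertex, which turns the sum into the setting of
  \<open>exponential_polynomial_unique_2D\<close>. All coefficients vanish there, so
  \<open>q v\<close> is zero at every argument.\<close>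

lemma bipoly_wave_sum_eq_0:
  fixes q :: "plane \<Rightarrow> complex \<Rightarrow> complex \<Rightarrow> complex"
  assumes V: "finite V" "card V \<le> M" "V \<subseteq> unit_square"
    and q: "\<And>v. bipoly d (q v)"
    and van: "\<And>r m n. 1 \<le> r \<Longrightarrow> r \<le> M \<Longrightarrow> m < d * (M div r) \<Longrightarrow> n < d * r \<Longrightarrow>
      (\<Sum>v\<in>V. q v (of_nat m) (of_nat n) * wave (of_nat m, of_nat n) v) = 0"
    and v: "v \<in> V"
  shows "q v x y = 0"
proof -
  define E where "E v = (exp (fourier_const * of_real (fst v)), exp (fourier_const * of_real (snd v)))"
    for v :: plane
  have inj: "inj_on E V"
  proof (rule inj_onI)
    fix v w assume vw: "v \<in> V" "w \<in> V" "E v = E w"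
    then have "v \<in> unit_square" "w \<in> unit_square" using V(3) by auto
    moreover have "exp (fourier_const * of_real (fst v)) = exp (fourier_const * of_real (fst w))"
      "exp (fourier_const * of_real (snd v)) = exp (fourier_const * of_real (snd w))"
      using vw(3) unfolding E_def by (simp_all only: prod.inject)
    ultimately show "v = w"
      by (intro prod_eqI exp_fourier_const_inj) (auto simp only: unit_square_def mem_Times_iff atLeastLessThan_iff)
  qed
  from q have "\<forall>v. \<exists>P :: nat \<Rightarrow> complex poly. (\<forall>i. degree (P i) < d) \<and>
     (\<forall>x y. q v x y = (\<Sum>i<d. poly (P i) y * x ^ i))"
    by (simp add: bipoly_def)
  from choice[OF this] obtain P :: "plane \<Rightarrow> nat \<Rightarrow> complex poly" where
    P: "\<And>v i. degree (P v i) < d" "\<And>v x y. q v x y = (\<Sum>i<d. poly (P v i) y * x ^ i)"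
    by blast
  \<comment> \<open>The coefficients are carried from the vertices to the nodes \<open>E v\<close>,
    which injectivity allows.\<close>
  define P' where "P' w = P (the_inv_into V E w)" for w
  have P': "P' (E v) = P v" if "v \<in> V" for v
    using inj that by (simp add: P'_def the_inv_into_f_f)
  have "P' (E v) i = 0" if "i < d" for i
  proof (rule exponential_polynomial_unique_2D[where V = "E ` V" and M = M and d = d])
    show "finite (E ` V)" "card (E ` V) \<le> M" "E v \<in> E ` V" "i < d"
      using V v that card_image_le[OF V(1), of E] by auto
    show "fst w \<noteq> 0 \<and> snd w \<noteq> 0" if "w \<in> E ` V" for w using that by (auto simp: E_def)
    show "degree (P' w i) < d" for w i using P(1) by (simp add: P'_def)
    fix r m n assume "1 \<le> r" "r \<le> M" "m < d * (M div r)" "n < d * r"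
    note 0 = van[OF this]
    have "(\<Sum>v\<in>E ` V. fst v ^ m * snd v ^ n * (\<Sum>i<d. poly (P' v i) (of_nat n) * of_nat m ^ i)) =
      (\<Sum>v\<in>V. fst (E v) ^ m * snd (E v) ^ n * (\<Sum>i<d. poly (P v i) (of_nat n) * of_nat m ^ i))"
      using P' by (simp add: sum.reindex[OF inj])
    also have "\<dots> = (\<Sum>v\<in>V. q v (of_nat m) (of_nat n) * wave (of_nat m, of_nat n) v)"
      by (intro sum.cong refl) (simp only: P(2) E_def wave_of_nat fst_conv snd_conv mult.commute)
    finally show "(\<Sum>v\<in>E ` V. fst v ^ m * snd v ^ n * (\<Sum>i<d. poly (P' v i) (of_nat n) * of_nat m ^ i)) = 0"
      using 0 by simp
  qed
  then show ?thesis using P' v P(2) by simp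
qed

text \<open>The grid needed in round \<open>r\<close> of the uniqueness proof lies in the rectangle
  of index \<open>r\<close>: \<open>d \<le> 2 * k \<le> 2 * (2 * k - 1)\<close> bounds the common
  factor, and \<open>2 * N div r\<close> is at most the floor of \<open>4 * N / r\<close>.\<close>

lemma sample_setI:
  assumes "1 \<le> k" "1 \<le> r" "r \<le> 2 * N" "m < d * (2 * N div r)" "n < d * r" "d \<le> 2 * k"
  shows "(int m, int n) \<in> sample_set k N"
proof -
  have "real (2 * N div r) \<le> 2 * real N / real r"
    using of_nat_div_le_of_nat[of "2 * N" r] by simp
  also have "\<dots> \<le> 4 * real N / real r" by (simp add: divide_right_mono)
  finally have fl: "int (2 * N div r) \<le> \<lfloor>4 * real N / real r\<rfloor>" by (simp add: le_floor_iff)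
  have "int d \<le> int (2 * k)" "1 \<le> int k" using assms(1,6) by simp_all
  then have d: "int d \<le> 2 * (2 * int k - 1)" by simp
  have "int m \<le> int d * int (2 * N div r)" using assms(4) by (simp flip: of_nat_mult)
  also have "\<dots> \<le> 2 * (2 * int k - 1) * \<lfloor>4 * real N / real r\<rfloor>"
    using d fl assms by (intro mult_mono) auto
  finally have m: "int m \<le> 2 * \<lfloor>4 * real N / real r\<rfloor> * (2 * int k - 1)" by (simp only: mult_ac)
  have "int n \<le> int d * int r" using assms(5) by (simp flip: of_nat_mult)
  also have "\<dots> \<le> 2 * (2 * int k - 1) * int r" using d by (intro mult_right_mono) auto
  finally have n: "int n \<le> 2 * int r * (2 * int k - 1)" by (simp only: mult_ac)
  show ?thesis
    unfolding sample_set_def using m n assms by (intro UN_I[of r]) auto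
qed

lemma slopes_generators:
  assumes "simple_polygon vs" "s \<in> slopes vs"
  shows "\<exists>u. u \<noteq> 0 \<and> s = span {u}"
proof -
  from assms(2) obtain j where j: "j < length vs" "s = span {vertex vs (Suc j) - vertex vs j}"
    by (auto simp: slopes_def slope_def)
  moreover have "vertex vs (Suc j) - vertex vs j \<noteq> 0"
    using simple_polygon_edge_nonzero[OF assms(1) j(1)] by simp
  ultimately show ?thesis by blast
qed

lemma polygon_determined_by_samples:
  assumes k: "2 \<le> k" and P: "P \<in> polygon_class k N" and Q: "Q \<in> polygon_class k N"
    and eq: "\<And>m n. (m, n) \<in> sample_set k N \<Longrightarrow>
      fourier (indicator P) (of_int m, of_int n) = fourier (indicator Q) (of_int m, of_int n)"
  shows "P = Q"
proof -
  from P obtain vs where vs: "simple_polygon vs" "P = polygonal_region vs" "set vs \<subseteq> unit_square"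
      "length vs \<le> N" "card (slopes vs) \<le> k" "P \<subseteq> unit_square"
    unfolding polygon_class_def by blast
  from Q obtain ws where ws: "simple_polygon ws" "Q = polygonal_region ws" "set ws \<subseteq> unit_square"
      "length ws \<le> N" "card (slopes ws) \<le> k" "Q \<subseteq> unit_square"
    unfolding polygon_class_def by blast
  define S where "S = slopes vs \<union> slopes ws"
  define V where "V = set vs \<union> set ws"
  have S: "finite S" "card S \<le> 2 * k"
    using card_Un_le[of "slopes vs" "slopes ws"] vs ws by (auto simp: S_def slopes_def)
  have V: "finite V" "card V \<le> 2 * N" "V \<subseteq> unit_square"
    using card_Un_le[of "set vs" "set ws"] card_length[of vs] card_length[of ws] vs ws
    by (auto simp: V_def)
  have "\<forall>s\<in>S. \<exists>u. u \<noteq> 0 \<and> s = span {u}"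
    using slopes_generators vs(1) ws(1) by (auto simp: S_def)
  from bchoice[OF this] obtain u where u: "\<And>s. s \<in> S \<Longrightarrow> s = span {u s}" "\<And>s. s \<in> S \<Longrightarrow> u s \<noteq> 0"
    by blast
  have cP: "continuous_on UNIV (fourier (indicator P))" and cQ: "continuous_on UNIV (fourier (indicator Q))"
    using vs ws by (auto intro!: continuous_on_fourier_indicator polygonal_region_measurable)
  \<comment> \<open>This multiplier depends only on \<open>S\<close>, hence serves both regions, and
    their difference is again an exponential polynomial with frequencies in
    \<open>V\<close>.\<close>
  let ?L = "\<lambda>\<xi>. fourier_const\<^sup>2 * of_real (snd \<xi>) * (\<Prod>s\<in>S. of_real (u s \<bullet> \<xi>))"
  obtain p where p: "\<And>v. bipoly (card S) (p v)"
    "\<And>\<xi>. ?L \<xi> * fourier (indicator P) \<xi> =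
      (\<Sum>v\<in>V. p v (of_real (fst \<xi>)) (of_real (snd \<xi>)) * wave \<xi> v)"
    using polygon_exponential_polynomial[OF vs(1,3), of S u V] vs cP S u V
    by (auto simp: S_def V_def)
  obtain q where q: "\<And>v. bipoly (card S) (q v)"
    "\<And>\<xi>. ?L \<xi> * fourier (indicator Q) \<xi> =
      (\<Sum>v\<in>V. q v (of_real (fst \<xi>)) (of_real (snd \<xi>)) * wave \<xi> v)"
    using polygon_exponential_polynomial[OF ws(1,3), of S u V] ws cQ S u V
    by (auto simp: S_def V_def)
  define D where "D v x y = p v x y + (-1) * q v x y" for v x y
  have D: "?L \<xi> * (fourier (indicator P) \<xi> - fourier (indicator Q) \<xi>) =
      (\<Sum>v\<in>V. D v (of_real (fst \<xi>)) (of_real (snd \<xi>)) * wave \<xi> v)" for \<xi>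
    unfolding right_diff_distrib p(2) q(2) D_def
    by (simp only: distrib_right sum.distrib sum_negf mult_minus1 mult_minus_left) simp
  have D0: "D v x y = 0" if "v \<in> V" for v x y
  proof (rule bipoly_wave_sum_eq_0[where q = D and d = "card S", OF V _ _ that])
    show "bipoly (card S) (D v)" for v
      unfolding D_def[abs_def] by (intro bipoly_add bipoly_cmult p q)
    fix r m n assume r: "1 \<le> r" "r \<le> 2 * N" "m < card S * (2 * N div r)" "n < card S * r"
    then have "(int m, int n) \<in> sample_set k N"
      using k S by (intro sample_setI[of k r N m "card S" n]) auto
    from eq[OF this] D[of "(of_nat m, of_nat n)"]
    show "(\<Sum>v\<in>V. D v (of_nat m) (of_nat n) * wave (of_nat m, of_nat n) v) = 0" by simp
  qed
  \<comment> \<open>Division by \<open>?L \<xi>\<close> is possible off finitely many lines;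
    continuity of both transforms covers the rest.\<close>
  have "fourier (indicator P) \<xi> = fourier (indicator Q) \<xi>" for \<xi>
  proof (rule continuous_eq_off_hyperplanes[OF _ _ cP cQ, where F = "insert (0, 1) (u ` S)"])
    show "finite (insert (0, 1) (u ` S))" "0 \<notin> insert (0, 1) (u ` S)"
      using S u(2) by (auto simp: unit_vector_neq_0)
    fix \<xi> assume gen: "\<And>n. n \<in> insert (0, 1) (u ` S) \<Longrightarrow> n \<bullet> \<xi> \<noteq> 0"
    have "snd \<xi> \<noteq> 0" "\<And>s. s \<in> S \<Longrightarrow> u s \<bullet> \<xi> \<noteq> 0"
      using gen[of "(0, 1)"] gen[of "u _"] by (simp_all add: inner_prod_def)
    then have "?L \<xi> \<noteq> 0" using S(1) by simp
    moreover have "?L \<xi> * (fourier (indicator P) \<xi> - fourier (indicator Q) \<xi>) = 0"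
      unfolding D using D0 by simp
    ultimately show "fourier (indicator P) \<xi> = fourier (indicator Q) \<xi>" by simp
  qed
  then show ?thesis
    using fourier_eq_imp_polygonal_region_eq[OF vs(1) _ ws(1)] vs(2,6) ws(2,6) by simp
qed

theorem corollary3p3:
  "(\<forall>k\<ge>2. \<forall>N\<ge>3. \<forall>P\<in>polygon_class k N. \<forall>Q\<in>polygon_class k N.
      (\<forall>(m, n)\<in>sample_set k N.
         fourier (indicator P) (of_int m, of_int n) = fourier (indicator Q) (of_int m, of_int n))
      \<longrightarrow> P = Q) \<and>
   (\<exists>C::real. \<forall>k\<ge>2. \<forall>N\<ge>3.
      real (card (sample_set k N)) \<le> C * real k ^ 2 * real N * ln (real N))"
proof (intro conjI allI impI ballI)
  fix k N :: nat and P Q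
  assume "2 \<le> k" and "P \<in> polygon_class k N" "Q \<in> polygon_class k N"
    and "\<forall>(m, n)\<in>sample_set k N.
      fourier (indicator P) (of_int m, of_int n) = fourier (indicator Q) (of_int m, of_int n)"
  then show "P = Q" by (intro polygon_determined_by_samples) auto
next
  show "\<exists>C::real. \<forall>k\<ge>2. \<forall>N\<ge>3.
      real (card (sample_set k N)) \<le> C * real k ^ 2 * real N * ln (real N)"
    using card_sample_set_le by blast
qed

end
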